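(* Let $p\ge3$, $n\ge1$, $d_1\ge\cdots\ge d_p>0$, $D=\mathrm{diag}(d_1,\dots,d_p)$ and $j\in\mathbb{R}$ with $\sum_{i=1}^p(d_i/d_1)^{1-j}-2>0$. If $d_1>d_2$, let $\eta_*$ be the unique root $\eta$ of $\sum_{i=1}^p(d_i/d_1)^{\eta}=2$ and let $\eta_{**}$ be any value in $(\max\{0,1-j\},\eta_* )$. If $d_1=d_2$, let $\eta_{**}$ be any value $>\max(1-j,0)$. Put $c_i=(d_1/d_i)^{j-1+\eta_{**}}$, $C=\mathrm{diag}(c_1,\dots,c_p)$, $$u_+=\frac{2}{n+2}\left(\sum_{i=1}^p(d_i/d_1)^{\eta_{**}}-2\right),\qquad v_+=\min_{i>k}\left(\frac{c_ic_k(d_1d_k-d_id_p)}{c_id_1d_k-c_kd_id_p}\right).$$ Suppose $(X',Z')'\in\mathbb{R}^p\times\mathbb{R}^n$ has density $\prod_i d_i^{-1/2}\,\sigma^{-p-n} f(\{(x-\theta)'D^{-1}(x-\theta)+z'z\}/\sigma^2)$. Let $\phi:(0,\infty)\to\mathbb{R}$ be differentiable and increasing ($\phi'\ge0$), with $0\le\phi(w)/w\le v_+$ for every $w>0$ and $\lim_{w\to\infty}\phi(w)\le u_+$. Then the estimator $$\hat\theta_\phi=\left(I-\frac{\phi(W)}{W}C^{-1}\right)X,\qquad W=X'C^{-1}D^{-1}X/Z'Z,$$ is minimax under $L_j(\delta,\theta,\sigma^2)=(\delta-\theta)'D^{-j}(\delta-\theta)/\sigma^2$ and condition number decreasing; further,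 $c_1\le\cdots\le c_p$.
   Context: Here $f:[0,\infty)\to[0,\infty)$ is a fixed function such that the displayed expression is a probability density and $X$ has finite second moments; $\theta\in\mathbb{R}^p$ and $\sigma>0$ are unknown. The risk is $R_j(\delta,\theta,\sigma^2)=E[L_j(\delta(X,Z),\theta,\sigma^2)]$. The estimator $X$ is minimax with constant risk, so $\delta$ is minimax if and only if $R_j(\delta,\theta,\sigma^2)\le R_j(X,\theta,\sigma^2)$ for all $\theta$, $\sigma>0$. The estimator $\hat\theta_\phi$ is condition number decreasing if, for every $w>0$, with $t=\phi(w)/w$, $$\frac{\max_i d_i(1-t/c_i)}{\min_i d_i(1-t/c_i)}\le\frac{d_1}{d_p}.$$ (The left side is the condition number of the matrix $G$ for which the corresponding regression coefficient estimator in the linear model $y=A\beta+\varepsilon$ is $\hat\beta_\phi=P\hat\theta_\phi=G^{-1}A'y$, and the right side is that of $A'A$ for least squares $\hat\beta=(A'A)^{-1}A'y$, where $P$ is orthogonal with $P'(A'A)^{-1}P=D$, and $X=P'\hat\beta$.)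
   Formalization: If all d_i are equal, every quotient in v_+ is 0/0 and v_+ is undefined; here v_+ is then taken to be 0, so that φ = 0 in that case. In all other cases the formula for v_+ is the stated one. *)

theory Defs
  imports "HOL-Probability.Probability"
begin

text \<open>
  Vectors in dimension p are of type \<^typ>\<open>real^'p\<close> with a finite linearly ordered index type, whose
  elements in increasing order play the role of 1, ..., p.
\<close>

abbreviation fst_ix :: "'p::{finite,linorder}" where
  "fst_ix \<equiv> Min UNIV"

abbreviation snd_ix :: "'p::{finite,linorder}" where
  "snd_ix \<equiv> Min (UNIV - {fst_ix})"

abbreviation last_ix :: "'p::{finite,linorder}" where
  "last_ix \<equiv> Max UNIV"

definition diag :: "real^'p \<Rightarrow> real^'p^'p" where
  "diag v = (\<chi> i k. if i = k then v $ i else 0)"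

definition diag_powr :: "real^'p \<Rightarrow> real \<Rightarrow> real^'p^'p" where
  "diag_powr v a = diag (\<chi> i. v $ i powr a)"

definition power_sum :: "real^'p::{finite,linorder} \<Rightarrow> real \<Rightarrow> real" where
  "power_sum d \<eta> = (\<Sum>i\<in>UNIV. (d $ i / d $ fst_ix) powr \<eta>)"

text \<open>Only meaningful if the second entry of \<open>d\<close> is smaller than the first.\<close>

definition eta_star :: "real^'p::{finite,linorder} \<Rightarrow> real" where
  "eta_star d = (THE \<eta>. power_sum d \<eta> = 2)"

definition c_vec :: "real^'p::{finite,linorder} \<Rightarrow> real \<Rightarrow> real \<Rightarrow> real^'p::{finite,linorder}" where
  "c_vec d j \<eta> = (\<chi> i. (d $ fst_ix / d $ i) powr (j - 1 + \<eta>))"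

definition u_plus :: "real^'p::{finite,linorder} \<Rightarrow> real \<Rightarrow> nat \<Rightarrow> real" where
  "u_plus d \<eta> n = 2 / (real n + 2) * (power_sum d \<eta> - 2)"

text \<open>
  If \<open>d\<close> is positive and decreasing and \<open>c\<close> positive and increasing, a denominator vanishes only if
  all entries of \<open>d\<close> coincide. Then each quotient in question is 0/0, which is 0 by the convention
  of the library.
\<close>

definition v_plus :: "real^'p::{finite,linorder} \<Rightarrow> real^'p::{finite,linorder} \<Rightarrow> real" where
  "v_plus d c = Min {c $ i * c $ k * (d $ fst_ix * d $ k - d $ i * d $ last_ix)
                     / (c $ i * d $ fst_ix * d $ k - c $ k * d $ i * d $ last_ix) | i k. k < i}"

definition sample_density ::
  "real^'p \<Rightarrow> (real \<Rightarrow> real) \<Rightarrow> real^'p \<Rightarrow> real \<Rightarrow> (real^'p) \<times> (real^'n) \<Rightarrow> real" where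
  "sample_density d f \<theta> \<sigma> = (\<lambda>(x, z).
     (\<Prod>i\<in>UNIV. d $ i powr (- 1 / 2)) * \<sigma> powi (- int CARD('p) - int CARD('n)) *
     f (((x - \<theta>) \<bullet> (matrix_inv (diag d) *v (x - \<theta>)) + z \<bullet> z) / \<sigma>\<^sup>2))"

definition sample_dist ::
  "real^'p \<Rightarrow> (real \<Rightarrow> real) \<Rightarrow> real^'p \<Rightarrow> real \<Rightarrow> ((real^'p) \<times> (real^'n)) measure" where
  "sample_dist d f \<theta> \<sigma> = density lborel (\<lambda>y. ennreal (sample_density d f \<theta> \<sigma> y))"

definition loss :: "real^'p \<Rightarrow> real \<Rightarrow> real^'p \<Rightarrow> real^'p \<Rightarrow> real \<Rightarrow> real" where
  "loss d j a \<theta> s = (a - \<theta>) \<bullet> (diag_powr d (- j) *v (a - \<theta>)) / s"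

text \<open>The loss is nonnegative, and its expectation may be infinite for a general estimator.\<close>

definition risk ::
  "real^'p \<Rightarrow> (real \<Rightarrow> real) \<Rightarrow> real \<Rightarrow> ((real^'p) \<times> (real^'n) \<Rightarrow> real^'p) \<Rightarrow> real^'p \<Rightarrow> real \<Rightarrow> ennreal"
  where
  "risk d f j \<delta> \<theta> \<sigma> = (\<integral>\<^sup>+ y. ennreal (loss d j (\<delta> y) \<theta> (\<sigma>\<^sup>2)) \<partial>sample_dist d f \<theta> \<sigma>)"

definition max_risk ::
  "real^'p \<Rightarrow> (real \<Rightarrow> real) \<Rightarrow> real \<Rightarrow> ((real^'p) \<times> (real^'n) \<Rightarrow> real^'p) \<Rightarrow> ennreal" where
  "max_risk d f j \<delta> = (SUP (\<theta>, \<sigma>) \<in> UNIV \<times> {0<..}. risk d f j \<delta> \<theta> \<sigma>)"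

definition minimax ::
  "real^'p \<Rightarrow> (real \<Rightarrow> real) \<Rightarrow> real \<Rightarrow> ((real^'p) \<times> (real^'n) \<Rightarrow> real^'p) \<Rightarrow> bool" where
  "minimax d f j \<delta> \<longleftrightarrow> \<delta> \<in> borel_measurable borel \<and>
     (\<forall>\<delta>' :: (real^'p) \<times> (real^'n) \<Rightarrow> real^'p. \<delta>' \<in> borel_measurable borel \<longrightarrow>
        max_risk d f j \<delta> \<le> max_risk d f j \<delta>')"

definition W_stat :: "real^'p \<Rightarrow> real^'p \<Rightarrow> real^'p \<Rightarrow> real^'n \<Rightarrow> real" where
  "W_stat d c x z =
     x \<bullet> ((matrix_inv (diag c) ** matrix_inv (diag d)) *v x) / (z \<bullet> z)"

definition theta_hat ::
  "real^'p \<Rightarrow> real^'p \<Rightarrow> (real \<Rightarrow> real) \<Rightarrow> (real^'p) \<times> (real^'n) \<Rightarrow> real^'p" where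
  "theta_hat d c \<phi> = (\<lambda>(x, z).
     (mat 1 - (\<phi> (W_stat d c x z) / W_stat d c x z) *\<^sub>R matrix_inv (diag c)) *v x)"

text \<open>The first conjunct rules out a spurious quotient with denominator 0.\<close>

definition cond_number_decreasing ::
  "real^'p::{finite,linorder} \<Rightarrow> real^'p::{finite,linorder} \<Rightarrow> (real \<Rightarrow> real) \<Rightarrow> bool" where
  "cond_number_decreasing d c \<phi> \<longleftrightarrow> (\<forall>w>0. let t = \<phi> w / w in
     (MIN i. d $ i * (1 - t / c $ i)) \<noteq> 0 \<and>
     (MAX i. d $ i * (1 - t / c $ i)) / (MIN i. d $ i * (1 - t / c $ i))
       \<le> d $ fst_ix / d $ last_ix)"

end

(*
  The estimator X is minimax: average the risk of any estimator over theta uniform in a ball of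
  radius N. Given the noise part of the data, the error e = X - theta restricted to a ball of
  radius M is symmetric as soon as X lies in the ball of radius N - M, so by the parallelogram law
  the estimator cannot beat X there; let N and then M tend to infinity.

  Domination of X uses Stein's identity with F(t) = (1/2) int_t^inf f in place of f, direction by
  direction. Along a line y + s b one has F(Q y) = const * int_0^inf (u y + s) f(Q(y + s b)) ds,
  so the identity is Tonelli plus translation invariance of Lebesgue measure. The terms with phi'
  have a favourable sign and are dropped at the level of one-dimensional increments, so only bounded
  functions are ever integrated against F and no integrability question about phi' arises.
  Writing A = X'C^-1 D^-1 X and B = X'C^-1 D^-j C^-1 X, the risk difference is at most
  int (phi/W) (-2 tr(D^(1-j) C^-1) + 4 B/A + (n+2) phi B/A) F, and c is chosen so that
  d_i^(1-j)/c_i is proportional to (d_i/d_1)^eta; hence B/A is at most d_1^(1-j) and the integrand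
  is nonpositive once phi is at most u_+.

  For the condition number, phi/w <= v_+ is, after clearing denominators, exactly
  d_i d_p (1 - t/c_i) <= d_1 d_k (1 - t/c_k) for k < i.
*)
theory Submission
  imports Defs
begin

section \<open>Coordinates and condition number\<close>

text \<open>No Gaussian form of the density is assumed, so integration by parts has to run through
  F: since F' = -f/2, the x_i-derivative of F(Q) is -(x_i - \<theta>_i) f(Q) / d_i. Each line is
  followed only outwards from the hyperplane x_i = \<theta>_i. The value picked up on that
  hyperplane is unchanged by reflection in it, while its factor x_i - \<theta>_i changes sign, so
  its contribution integrates to zero. The lower bounds on \<eta> serve two ends: 1 - j < \<eta>
  makes c increasing, which the condition number needs, and 0 < \<eta> makes i = 1 the index of the
  largest weight, which bounds B/A. With this bound the integrand is nonpositive as soon as 4 +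
  (n+2) phi is at most twice the sum of the (d_i/d_1)^\<eta>, and this is phi \<le> u_+. The number
  n+2 is the sum of 1 + 2 z_k^2 / |z|^2 over the n noise directions. The function phi may behave
  arbitrarily off the positive axis, and W is singular where x = 0 or z = 0. These points form a
  null set, but lines may run into it; this is why the one-dimensional estimates are only claimed
  for almost every starting point.\<close>

lemma matrix_inv_diag:
  fixes v :: "real^'p"
  assumes "\<And>i. v $ i \<noteq> 0"
  shows "matrix_inv (diag v) = diag (\<chi> i. 1 / v $ i)"
proof -
  have *: "diag a ** diag b = diag (\<chi> i. a $ i * b $ i)" for a b :: "real^'p"
    by (simp add: diag_def matrix_matrix_mult_def vec_eq_iff if_distrib[of "\<lambda>t. t * _"] cong: if_cong)
  have 1: "diag (\<chi> i. 1) = (mat 1 :: real^'p^'p)"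
    by (simp add: diag_def mat_def vec_eq_iff)
  have "matrix_inv (diag v) ** diag v = mat 1"
    unfolding matrix_inv_def
    by (rule conjunct2[OF someI[of _ "diag (\<chi> i. 1 / v $ i)"]]) (use assms in \<open>simp add: * 1\<close>)
  then have "matrix_inv (diag v) ** (diag v ** diag (\<chi> i. 1 / v $ i)) = diag (\<chi> i. 1 / v $ i)"
    by (simp add: matrix_mul_assoc)
  then show ?thesis using assms by (simp add: * 1)
qed

lemma diag_mult_vec: "diag v *v x = (\<chi> i. v $ i * x $ i)"
  by (simp add: diag_def matrix_vector_mult_def vec_eq_iff if_distrib[of "\<lambda>t. t * _"] cong: if_cong)

lemma inner_diag: "x \<bullet> (diag v *v y) = (\<Sum>i\<in>UNIV. v $ i * x $ i * y $ i)"
  by (simp add: diag_mult_vec inner_vec_def mult_ac)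

lemma loss_eq: "loss d j a \<theta> s = (\<Sum>i\<in>UNIV. d $ i powr (-j) * (a $ i - \<theta> $ i)\<^sup>2) / s"
  by (simp add: loss_def diag_powr_def inner_diag power2_eq_square mult_ac)

lemma sample_density_eq:
  fixes d :: "real^'p"
  assumes "\<And>i. 0 < d $ i"
  shows "sample_density d f \<theta> \<sigma> (x, z :: real^'n) =
     (\<Prod>i\<in>UNIV. d $ i powr (- 1 / 2)) * \<sigma> powi (- int CARD('p) - int CARD('n)) *
     f (((\<Sum>i\<in>UNIV. (x $ i - \<theta> $ i)\<^sup>2 / d $ i) + z \<bullet> z) / \<sigma>\<^sup>2)"
  using assms by (simp add: sample_density_def matrix_inv_diag less_imp_neq[symmetric] inner_diag power2_eq_square)

lemma W_stat_eq:
  assumes "\<And>i. 0 < d $ i" "\<And>i. 0 < c $ i"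
  shows "W_stat d c x z = (\<Sum>i\<in>UNIV. (x $ i)\<^sup>2 / (c $ i * d $ i)) / (z \<bullet> z)"
  using assms by (simp add: W_stat_def matrix_inv_diag less_imp_neq[symmetric] inner_diag power2_eq_square
    matrix_vector_mul_assoc[symmetric])
    (simp add: diag_mult_vec inner_vec_def mult_ac)

lemma theta_hat_eq:
  assumes "\<And>i. 0 < c $ i"
  shows "theta_hat d c \<phi> (x, z) $ i =
    (1 - (\<phi> (W_stat d c x z) / W_stat d c x z) / c $ i) * x $ i"
  using assms by (simp add: theta_hat_def matrix_inv_diag less_imp_neq[symmetric] matrix_vector_mult_diff_rdistrib
     scaleR_matrix_vector_assoc[symmetric] diag_mult_vec algebra_simps)

text \<open>Once all g_i = d_i (1 - t/c_i) are positive, the claim is g_i d_p \<le> d_1 g_k for all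
  i and k. Pairs with k < i are the ones \<open>v_plus\<close> controls; for the others, d_i d_p
  \<le> d_1 d_k and t/c_k \<le> t/c_i follow from monotonicity. Positivity is extracted from the
  extreme pair.\<close>

lemma cond_number_decreasingI:
  fixes d c :: "real^'p::{finite,linorder}"
  assumes d_pos: "\<And>i. 0 < d $ i"
    and d_decreasing: "\<And>i k. i \<le> k \<Longrightarrow> d $ k \<le> d $ i"
    and c_pos: "\<And>i. 0 < c $ i"
    and c_mono: "\<And>i k. i \<le> k \<Longrightarrow> c $ i \<le> c $ k"
    and c_strict: "d $ last_ix < d $ fst_ix \<Longrightarrow> c $ fst_ix < c $ last_ix"
    and p: "CARD('p) \<ge> 2"
    and bounds: "\<And>w. 0 < w \<Longrightarrow> 0 \<le> \<phi> w / w \<and> \<phi> w / w \<le> v_plus d c"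
  shows "cond_number_decreasing d c \<phi>"
proof -
  let ?one = "fst_ix :: 'p" and ?p = "last_ix :: 'p"
  have le: "?one \<le> i" "i \<le> ?p" for i by simp_all
  have ne: "?one \<noteq> ?p"
  proof
    assume "?one = ?p"
    then have "(UNIV :: 'p set) = {?one}" using le by (metis UNIV_eq_I antisym singletonI)
    then show False using p by (metis card_1_singleton_iff One_nat_def Suc_1 not_less_eq_eq order_refl)
  qed
  then have lt: "?one < ?p" using le(1)[of ?p] by (rule le_neq_trans[rotated])
  have v_le: "v_plus d c \<le> c $ i * c $ k * (d $ ?one * d $ k - d $ i * d $ ?p)
                     / (c $ i * d $ ?one * d $ k - c $ k * d $ i * d $ ?p)" if "k < i" for i k
  proof -
    have "finite {c $ i * c $ k * (d $ ?one * d $ k - d $ i * d $ ?p)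
                     / (c $ i * d $ ?one * d $ k - c $ k * d $ i * d $ ?p) | i k. k < i}"
      by (rule finite_subset[of _ "(\<lambda>(i, k). c $ i * c $ k * (d $ ?one * d $ k - d $ i * d $ ?p)
                     / (c $ i * d $ ?one * d $ k - c $ k * d $ i * d $ ?p)) ` UNIV"]) (auto simp del: Min_le_iff)
    then show ?thesis unfolding v_plus_def by (rule Min_le) (use that in blast)
  qed
  show ?thesis unfolding cond_number_decreasing_def Let_def
  proof (intro allI impI)
    fix w :: real assume w: "0 < w"
    define t where "t = \<phi> w / w"
    have t: "0 \<le> t" "t \<le> v_plus d c" using bounds[OF w] by (auto simp: t_def)
    define g where "g i = d $ i * (1 - t / c $ i)" for i
    have key: "(\<forall>i. 0 < g i) \<and> (\<forall>i k. g i * d $ ?p \<le> d $ ?one * g k)"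
    proof (cases "d $ ?p < d $ ?one")
      case False
      then have "d $ i = d $ ?one" for i
        using d_decreasing[of i ?p] d_decreasing[of ?one i] by simp
      then obtain e where eq: "d $ i = e" for i by blast
      \<comment> \<open>All numerators in \<open>v_plus\<close> are 0 here, which forces t = 0 and
        hence equality in the bound.\<close>
      have "t \<le> 0" using v_le[OF lt] t by (simp add: eq)
      then have "t = 0" using t by simp
      then show ?thesis using d_pos[of ?one] by (simp add: g_def eq)
    next
      case True
      have num: "0 < d $ ?one * d $ k - d $ i * d $ ?p" if "k < i" for i k
      proof (cases "d $ i = d $ ?one")
        case True
        then have "d $ ?one \<le> d $ k" using d_decreasing[of k i] that by simp
        then show ?thesis using \<open>d $ ?p < d $ ?one\<close> True d_pos[of ?one] by simp
      next
        case False
        then have "d $ i < d $ ?one" using d_decreasing[of ?one i] by simp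
        then have "d $ i * d $ ?p < d $ ?one * d $ ?p" using d_pos by simp
        also have "\<dots> \<le> d $ ?one * d $ k" using d_pos[of ?one] d_decreasing[of k ?p] by simp
        finally show ?thesis by simp
      qed
      have den: "0 < c $ i * d $ ?one * d $ k - c $ k * d $ i * d $ ?p" if "k < i" for i k
      proof -
        have "0 < c $ k * (d $ ?one * d $ k - d $ i * d $ ?p)" using num[OF that] c_pos by simp
        also have "\<dots> \<le> c $ i * d $ ?one * d $ k - c $ k * d $ i * d $ ?p"
          using mult_right_mono[OF c_mono[of k i], of "d $ ?one * d $ k"] that d_pos
          by (simp add: algebra_simps less_imp_le)
        finally show ?thesis .
      qed
      have t_le: "t * (c $ i * d $ ?one * d $ k - c $ k * d $ i * d $ ?p) \<le>
          c $ i * c $ k * (d $ ?one * d $ k - d $ i * d $ ?p)" if "k < i" for i k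
      proof -
        have "t \<le> c $ i * c $ k * (d $ ?one * d $ k - d $ i * d $ ?p)
                     / (c $ i * d $ ?one * d $ k - c $ k * d $ i * d $ ?p)"
          using v_le[OF that] t by simp
        then show ?thesis using den[OF that] by (simp add: pos_le_divide_eq)
      qed
      \<comment> \<open>At i = p, k = 1 the quotient in \<open>v_plus\<close> is strictly below c_1,
        because c_1 < c_p. Hence t < c_1, and every 1 - t/c_i is positive.\<close>
      have "c $ ?p * c $ ?one * (d $ ?one * d $ ?one - d $ ?p * d $ ?p) <
          c $ ?one * (c $ ?p * d $ ?one * d $ ?one - c $ ?one * d $ ?p * d $ ?p)"
      proof -
        have "c $ ?one * (c $ ?one * (d $ ?p * d $ ?p)) < c $ ?one * (c $ ?p * (d $ ?p * d $ ?p))"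
          using c_strict[OF True] c_pos d_pos by simp
        then show ?thesis by (simp add: algebra_simps)
      qed
      then have "t * (c $ ?p * d $ ?one * d $ ?one - c $ ?one * d $ ?p * d $ ?p) <
          c $ ?one * (c $ ?p * d $ ?one * d $ ?one - c $ ?one * d $ ?p * d $ ?p)"
        using t_le[OF lt] by linarith
      then have "t < c $ ?one" using den[OF lt] by simp
      then have tc: "t < c $ i" for i using c_mono[of ?one i] le by (meson less_le_trans)
      have pos: "0 < g i" for i unfolding g_def
        using tc[of i] c_pos[of i] d_pos[of i] by simp
      have "g i * d $ ?p \<le> d $ ?one * g k" for i k
      proof (cases "k < i")
        case True
        have "c $ i * c $ k * (d $ ?one * g k - g i * d $ ?p) =
            c $ i * c $ k * (d $ ?one * d $ k - d $ i * d $ ?p) -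
            t * (c $ i * d $ ?one * d $ k - c $ k * d $ i * d $ ?p)"
          using c_pos[of i] c_pos[of k] unfolding g_def by (simp add: field_simps)
        then have "0 \<le> c $ i * c $ k * (d $ ?one * g k - g i * d $ ?p)" using t_le[OF True] by simp
        moreover have "0 < c $ i * c $ k" using c_pos by simp
        ultimately show ?thesis by (simp add: zero_le_mult_iff)
      next
        case False
        then have "t / c $ k \<le> t / c $ i" using c_mono[of i k] c_pos t
          by (intro divide_left_mono) auto
        then have "1 - t / c $ i \<le> 1 - t / c $ k" by simp
        moreover have "0 < 1 - t / c $ i" using tc[of i] c_pos[of i] by simp
        moreover have "d $ i * d $ ?p \<le> d $ ?one * d $ k"
          using d_pos by (intro mult_mono d_decreasing le) (auto simp: less_imp_le)
        ultimately have "(d $ i * d $ ?p) * (1 - t / c $ i) \<le> (d $ ?one * d $ k) * (1 - t / c $ k)"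
          using d_pos by (intro mult_mono[of "_ * _"]) (auto simp: less_imp_le)
        then show ?thesis by (simp add: g_def mult_ac)
      qed
      then show ?thesis using pos by blast
    qed
    obtain k where k: "(MIN i. g i) = g k"
      using rangeE[OF Min_in[of "range g"]] by auto
    obtain i where i: "(MAX i. g i) = g i"
      using rangeE[OF Max_in[of "range g"]] by auto
    have "(MIN i. g i) \<noteq> 0 \<and> (MAX i. g i) / (MIN i. g i) \<le> d $ ?one / d $ ?p"
      unfolding k i using key d_pos[of ?p]
      by (auto simp: divide_simps less_imp_neq[symmetric] not_less less_imp_le dest: less_imp_not_less)
    then show "(MIN i. d $ i * (1 - \<phi> w / w / c $ i)) \<noteq> 0 \<and>
      (MAX i. d $ i * (1 - \<phi> w / w / c $ i)) / (MIN i. d $ i * (1 - \<phi> w / w / c $ i)) \<le> d $ ?one / d $ ?p"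
      by (simp add: g_def t_def)
  qed
qed

section \<open>Minimaxity of the unbiased estimator\<close>

lemma nn_integral_lborel_translate:
  fixes f :: "'a::euclidean_space \<Rightarrow> ennreal"
  assumes [measurable]: "f \<in> borel_measurable borel"
  shows "(\<integral>\<^sup>+ x. f (x + a) \<partial>lborel) = (\<integral>\<^sup>+ x. f x \<partial>lborel)"
proof -
  have "(\<integral>\<^sup>+ x. f x \<partial>lborel) = (\<integral>\<^sup>+ x. f x \<partial>distr lborel borel ((+) a))"
    by (simp add: lborel_distr_plus)
  also have "\<dots> = (\<integral>\<^sup>+ x. f (x + a) \<partial>lborel)"
    by (subst nn_integral_distr) (auto simp: add.commute)
  finally show ?thesis ..
qed

lemma nn_integral_lborel_reflect:
  fixes f :: "'a::euclidean_space \<Rightarrow> ennreal"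
  assumes [measurable]: "f \<in> borel_measurable borel"
  shows "(\<integral>\<^sup>+ x. f (a - x) \<partial>lborel) = (\<integral>\<^sup>+ x. f x \<partial>lborel)"
proof -
  have "lborel = distr lborel borel (\<lambda>x::'a. a - x)"
    using lborel_affine[of "-1" a] by (simp add: density_1)
  then have "(\<integral>\<^sup>+ x. f x \<partial>lborel) = (\<integral>\<^sup>+ x. f x \<partial>distr lborel borel (\<lambda>x::'a. a - x))" by simp
  also have "\<dots> = (\<integral>\<^sup>+ x. f (a - x) \<partial>lborel)"
    by (subst nn_integral_distr) auto
  finally show ?thesis ..
qed

lemma nn_integral_lborel_pair:
  fixes f :: "'a::euclidean_space \<times> 'b::euclidean_space \<Rightarrow> ennreal"
  assumes [measurable]: "f \<in> borel_measurable borel"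
  shows "(\<integral>\<^sup>+ y. f y \<partial>lborel) = (\<integral>\<^sup>+ z. \<integral>\<^sup>+ x. f (x, z) \<partial>lborel \<partial>lborel)"
    and "(\<integral>\<^sup>+ y. f y \<partial>lborel) = (\<integral>\<^sup>+ x. \<integral>\<^sup>+ z. f (x, z) \<partial>lborel \<partial>lborel)"
proof -
  have "f \<in> borel_measurable (lborel \<Otimes>\<^sub>M lborel)"
    by (simp add: lborel_prod)
  then show "(\<integral>\<^sup>+ y. f y \<partial>lborel) = (\<integral>\<^sup>+ z. \<integral>\<^sup>+ x. f (x, z) \<partial>lborel \<partial>lborel)"
    and "(\<integral>\<^sup>+ y. f y \<partial>lborel) = (\<integral>\<^sup>+ x. \<integral>\<^sup>+ z. f (x, z) \<partial>lborel \<partial>lborel)"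
    using lborel_pair.nn_integral_snd[of f] lborel.nn_integral_fst[of f] by (simp_all add: lborel_prod)
qed

text \<open>Averaging the shifted integrand over e and -e gives q a + q e by the parallelogram law,
  and q a is nonnegative. Only a factor 2 is cancelled, so infinite integrals are covered.\<close>

lemma nn_integral_translate_even_ge:
  fixes h :: "'a::euclidean_space \<Rightarrow> ennreal" and q :: "'a \<Rightarrow> real"
  assumes h[measurable]: "h \<in> borel_measurable borel" and even: "\<And>e. h (- e) = h e"
    and q[measurable]: "q \<in> borel_measurable borel" and q_nonneg: "\<And>e. 0 \<le> q e"
    and parallelogram: "\<And>a e. q (a + e) + q (a - e) = 2 * q a + 2 * q e"
  shows "(\<integral>\<^sup>+ e. ennreal (q e) * h e \<partial>lborel) \<le> (\<integral>\<^sup>+ e. ennreal (q (a + e)) * h e \<partial>lborel)"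
proof -
  let ?I = "\<integral>\<^sup>+ e. ennreal (q (a + e)) * h e \<partial>lborel"
  have "?I = (\<integral>\<^sup>+ e. ennreal (q (a + (0 - e))) * h (0 - e) \<partial>lborel)"
    by (rule nn_integral_lborel_reflect[symmetric]) simp
  then have refl: "?I = (\<integral>\<^sup>+ e. ennreal (q (a - e)) * h e \<partial>lborel)"
    by (simp add: even)
  have "2 * (\<integral>\<^sup>+ e. ennreal (q e) * h e \<partial>lborel) = (\<integral>\<^sup>+ e. ennreal (2 * q e) * h e \<partial>lborel)"
    by (subst nn_integral_cmult[symmetric]) (auto simp: ennreal_mult'' q_nonneg mult.assoc ennreal_mult')
  also have "\<dots> \<le> (\<integral>\<^sup>+ e. ennreal (q (a + e)) * h e + ennreal (q (a - e)) * h e \<partial>lborel)"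
    by (intro nn_integral_mono)
      (auto simp: distrib_right[symmetric] ennreal_plus[symmetric] q_nonneg parallelogram simp del: ennreal_plus
        intro!: mult_right_mono ennreal_leI)
  also have "\<dots> = ?I + ?I"
    by (subst nn_integral_add) (auto simp: refl[symmetric])
  also have "\<dots> = 2 * ?I" by (simp add: mult_2)
  finally show ?thesis
    by (simp add: ennreal_mult_le_mult_iff)
qed

text \<open>A bound for the risk at every \<theta> bounds every average over \<theta>; balls of
  growing radius stand in for a uniform prior on the whole space. Cutting the error off at a fixed
  radius M before N grows confines the boundary effect to the factor 1 - M/N, raised to the
  dimension. Extended integrals admit infinite risk.\<close>

lemma location_risk_lower_bound:
  fixes k :: "'a::euclidean_space \<times> 'b::euclidean_space \<Rightarrow> ennreal" and q :: "'a \<Rightarrow> real"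
    and \<delta> :: "'a \<times> 'b \<Rightarrow> 'a"
  assumes k: "k \<in> borel_measurable borel" and even: "\<And>e z. k (- e, z) = k (e, z)"
    and q[measurable]: "q \<in> borel_measurable borel" and q_nonneg: "\<And>e. 0 \<le> q e"
    and parallelogram: "\<And>a e. q (a + e) + q (a - e) = 2 * q a + 2 * q e"
    and \<delta>: "\<delta> \<in> borel_measurable borel"
    and R: "\<And>\<theta>. (\<integral>\<^sup>+ y. ennreal (q (\<delta> y - \<theta>)) * k (fst y - \<theta>, snd y) \<partial>lborel) \<le> R"
  shows "(\<integral>\<^sup>+ y. ennreal (q (fst y)) * k y \<partial>lborel) \<le> R"
proof -
  let ?n = "DIM('a)"
  define r where "r M = (\<integral>\<^sup>+ y. ennreal (q (fst y)) * (k y * indicator (cball 0 M) (fst y)) \<partial>lborel)" for M :: real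
  have prod_borel: "(borel :: ('a \<times> 'b) measure) = borel \<Otimes>\<^sub>M borel"
    by (rule borel_prod[symmetric])
  have k'[measurable]: "k \<in> borel_measurable (borel \<Otimes>\<^sub>M borel)" using k by (simp add: borel_prod)
  have \<delta>'[measurable]: "\<delta> \<in> borel_measurable (borel \<Otimes>\<^sub>M borel)" using \<delta> by (simp add: borel_prod)
  have [measurable]: "cball (0::'a) M \<in> sets borel" for M by simp
  have bound: "r M * ennreal ((1 - M / N) ^ ?n) \<le> R" if M: "0 < M" and N: "M < N" for M N :: real
  proof -
    define V where "V = unit_ball_vol (real ?n)"
    have V: "0 < V" by (simp add: V_def)
    \<comment> \<open>The integrand of the averaged risk of \<delta>, for the unnormalized uniform
      weight on the ball of radius N, as a function of the parameter and the data.\<close>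
    define G where "G = (\<lambda>(\<theta>, x, z). if norm \<theta> \<le> N then
       ennreal (q (\<delta> (x, z) - \<theta>)) * k (x - \<theta>, z) else 0)"
    have G[measurable]: "G \<in> borel_measurable (borel \<Otimes>\<^sub>M (borel \<Otimes>\<^sub>M borel))"
      unfolding G_def by measurable
    then have G'[measurable]: "G \<in> borel_measurable borel" by (simp add: borel_prod)
    have vol: "(\<integral>\<^sup>+ x. indicator (cball 0 (N - M)) x * r M \<partial>(lborel :: 'a measure)) =
       r M * ennreal (V * (N - M) ^ ?n)"
      using M N by (subst nn_integral_multc) (simp_all add: emeasure_cball V_def mult.commute)
    have "(\<integral>\<^sup>+ x. indicator (cball 0 (N - M)) x * r M \<partial>(lborel :: 'a measure)) =
       (\<integral>\<^sup>+ x. indicator (cball 0 (N - M)) x *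
          (\<integral>\<^sup>+ z. \<integral>\<^sup>+ e. ennreal (q e) * (k (e, z) * indicator (cball 0 M) e) \<partial>lborel \<partial>lborel) \<partial>(lborel :: 'a measure))"
      unfolding r_def by (subst nn_integral_lborel_pair(1)) (simp_all add: prod_borel)
    \<comment> \<open>For fixed (x, z) the estimator enters only through the shift a = \<delta>(x,
      z) - x, because \<delta> - \<theta> = a + e for e = x - \<theta>. The truncated kernel is
      still even in e.\<close>
    also have "\<dots> \<le> (\<integral>\<^sup>+ x. indicator (cball 0 (N - M)) x *
        (\<integral>\<^sup>+ z. \<integral>\<^sup>+ e. ennreal (q (\<delta> (x, z) - x + e)) * (k (e, z) * indicator (cball 0 M) e) \<partial>lborel \<partial>lborel) \<partial>(lborel :: 'a measure))"
      by (intro nn_integral_mono mult_left_mono nn_integral_translate_even_ge[OF _ _ q q_nonneg parallelogram])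
        (auto simp: even indicator_def)
    also have "\<dots> \<le> (\<integral>\<^sup>+ x. \<integral>\<^sup>+ z. \<integral>\<^sup>+ e. G (x - e, x, z) \<partial>lborel \<partial>lborel \<partial>lborel)"
    proof (rule nn_integral_mono)
      fix x :: 'a
      show "indicator (cball 0 (N - M)) x *
        (\<integral>\<^sup>+ z. \<integral>\<^sup>+ e. ennreal (q (\<delta> (x, z) - x + e)) * (k (e, z) * indicator (cball 0 M) e) \<partial>lborel \<partial>lborel)
        \<le> (\<integral>\<^sup>+ z. \<integral>\<^sup>+ e. G (x - e, x, z) \<partial>lborel \<partial>lborel)"
      proof (cases "x \<in> cball 0 (N - M)")
        case True
        have "norm (x - e) \<le> N" if "norm e \<le> M" for e
          using norm_triangle_ineq4[of x e] True that by simp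
        then show ?thesis using True
          by (auto intro!: nn_integral_mono simp: G_def algebra_simps split: split_indicator)
      qed simp
    qed
    also have "\<dots> = (\<integral>\<^sup>+ x. \<integral>\<^sup>+ z. \<integral>\<^sup>+ \<theta>. G (\<theta>, x, z) \<partial>lborel \<partial>lborel \<partial>lborel)"
      by (intro nn_integral_cong nn_integral_lborel_reflect[where f="\<lambda>\<theta>. G (\<theta>, _, _)"]) measurable
    also have "\<dots> = (\<integral>\<^sup>+ y. \<integral>\<^sup>+ \<theta>. G (\<theta>, y) \<partial>lborel \<partial>lborel)"
      by (subst nn_integral_lborel_pair(2)) (simp_all add: prod_borel)
    also have "\<dots> = (\<integral>\<^sup>+ \<theta>. \<integral>\<^sup>+ y. G (\<theta>, y) \<partial>lborel \<partial>lborel)"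
      by (subst nn_integral_lborel_pair(1,2)[symmetric]) (simp_all add: nn_integral_lborel_pair)
    also have "\<dots> \<le> (\<integral>\<^sup>+ \<theta>. R * indicator (cball 0 N) \<theta> \<partial>(lborel :: 'a measure))"
    proof (rule nn_integral_mono)
      fix \<theta> :: 'a
      have "(\<integral>\<^sup>+ y. G (\<theta>, y) \<partial>lborel) = indicator (cball 0 N) \<theta> *
         (\<integral>\<^sup>+ y. ennreal (q (\<delta> y - \<theta>)) * k (fst y - \<theta>, snd y) \<partial>lborel)"
        by (cases "norm \<theta> \<le> N") (simp_all add: G_def case_prod_beta)
      also have "\<dots> \<le> indicator (cball 0 N) \<theta> * R" by (intro mult_left_mono R) simp
      finally show "(\<integral>\<^sup>+ y. G (\<theta>, y) \<partial>lborel) \<le> R * indicator (cball 0 N) \<theta>"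
        by (simp add: mult.commute)
    qed
    also have "\<dots> = R * ennreal (V * N ^ ?n)"
      using M N by (simp add: nn_integral_cmult emeasure_cball V_def)
    finally have *: "r M * ennreal (V * (N - M) ^ ?n) \<le> R * ennreal (V * N ^ ?n)"
      unfolding vol .
    have "r M * ennreal ((1 - M / N) ^ ?n) = r M * ennreal (V * (N - M) ^ ?n) * ennreal (1 / (V * N ^ ?n))"
      using M N V by (simp add: mult.assoc ennreal_mult'[symmetric] power_divide[symmetric] diff_divide_distrib)
    also have "\<dots> \<le> R * ennreal (V * N ^ ?n) * ennreal (1 / (V * N ^ ?n))"
      by (intro mult_right_mono *) simp
    also have "\<dots> = R"
      using M N V by (simp add: mult.assoc ennreal_mult'[symmetric])
    finally show ?thesis .
  qed
  \<comment> \<open>Allowing a loss e in the factor reduces the limit in N to the choice of one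
    large N; e tends to 0 in \<open>r_le\<close>.\<close>
  have lim: "r M * ennreal (1 - e) \<le> R" if "0 < M" "0 < e" for M e :: real
  proof -
    have "((\<lambda>N. (1 - M / N) ^ ?n) \<longlongrightarrow> (1 - 0) ^ ?n) at_top"
      by (intro tendsto_power tendsto_diff tendsto_const real_tendsto_divide_at_top[OF tendsto_const filterlim_ident])
    then have "eventually (\<lambda>N. 1 - e < (1 - M / N) ^ ?n) at_top"
      by (rule order_tendstoD) (use that in simp)
    then have "eventually (\<lambda>N. 1 - e < (1 - M / N) ^ ?n \<and> M < N) at_top"
      by (intro eventually_conj eventually_gt_at_top)
    then obtain N where N: "1 - e < (1 - M / N) ^ ?n" "M < N"
      using eventually_happens[of _ "at_top :: real filter"] by auto
    have "r M * ennreal (1 - e) \<le> r M * ennreal ((1 - M / N) ^ ?n)"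
      by (intro mult_left_mono ennreal_leI) (use N in auto)
    also have "\<dots> \<le> R" by (rule bound) (use that N in auto)
    finally show ?thesis .
  qed
  have r_le: "r M \<le> R" if "0 < M" for M
  proof (rule LIMSEQ_le_const2)
    have "(\<lambda>i. ennreal (1 - inverse (real (Suc i)))) \<longlonglongrightarrow> ennreal (1 - 0)"
      by (intro tendsto_ennrealI tendsto_diff tendsto_const LIMSEQ_inverse_real_of_nat)
    then have "(\<lambda>i. ennreal (1 - inverse (real (Suc i))) * r M) \<longlonglongrightarrow> ennreal (1 - 0) * r M"
      by (intro tendsto_mult_ennreal tendsto_const) auto
    then show "(\<lambda>i. r M * ennreal (1 - inverse (real (Suc i)))) \<longlonglongrightarrow> r M"
      by (simp add: mult.commute)
    show "\<exists>N. \<forall>i\<ge>N. r M * ennreal (1 - inverse (real (Suc i))) \<le> R"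
      using lim[OF that] by auto
  qed
  \<comment> \<open>The cut-off is removed by monotone convergence; the radii are
    \<open>Suc m\<close> because \<open>r_le\<close> asks for a positive radius.\<close>
  have "(\<integral>\<^sup>+ y. ennreal (q (fst y)) * k y \<partial>lborel) =
     (\<integral>\<^sup>+ y. (SUP m. ennreal (q (fst y)) * (k y * indicator (cball 0 (real (Suc m))) (fst y))) \<partial>lborel)"
  proof (rule nn_integral_cong)
    fix y :: "'a \<times> 'b"
    obtain m :: nat where m: "norm (fst y) < m" using reals_Archimedean2 by blast
    show "ennreal (q (fst y)) * k y = (SUP m. ennreal (q (fst y)) * (k y * indicator (cball 0 (real (Suc m))) (fst y)))"
    proof (rule antisym)
      show "ennreal (q (fst y)) * k y \<le> (SUP m. ennreal (q (fst y)) * (k y * indicator (cball 0 (real (Suc m))) (fst y)))"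
        by (rule SUP_upper2[of m]) (use m in \<open>auto simp: indicator_def\<close>)
      show "(SUP m. ennreal (q (fst y)) * (k y * indicator (cball 0 (real (Suc m))) (fst y))) \<le> ennreal (q (fst y)) * k y"
        by (rule SUP_least) (auto simp: indicator_def)
    qed
  qed
  also have "\<dots> = (SUP m. r (real (Suc m)))"
    unfolding r_def
    by (subst nn_integral_monotone_convergence_SUP)
      (auto simp: incseq_def le_fun_def prod_borel intro!: mult_left_mono split: split_indicator)
  also have "\<dots> \<le> R" by (intro SUP_least r_le) simp
  finally show ?thesis .
qed

section \<open>Stein inequalities\<close>

text \<open>
  Extended values are needed: the function may be infinite at 0.
\<close>

definition tail :: "(real \<Rightarrow> real) \<Rightarrow> real \<Rightarrow> ennreal" where
  "tail g t = (\<integral>\<^sup>+ s. ennreal (g s / 2) * indicator {t..} s \<partial>lborel)"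

lemma tail_measurable[measurable]:
  assumes [measurable]: "g \<in> borel_measurable borel"
  shows "tail g \<in> borel_measurable borel"
proof -
  \<comment> \<open>With the indicator read as that of a set of pairs (t, s), measurability of an
    integral in its parameter applies.\<close>
  have *: "tail g = (\<lambda>t. \<integral>\<^sup>+ s. ennreal (g s / 2) * indicator {p. fst p \<le> snd p} (t, s) \<partial>lborel)"
    by (auto simp: tail_def fun_eq_iff intro!: nn_integral_cong split: split_indicator)
  show ?thesis unfolding * by measurable
qed

text \<open>Integrates \<open>g\<close> along the ray on which the quadratic form grows from \<open>q\<close> to infinity.\<close>

lemma tail_substitution:
  assumes [measurable]: "g \<in> borel_measurable borel" and g: "\<And>t. 0 \<le> g t" and "0 \<le> u" "0 < d"
  shows "ennreal d * tail g q =
     (\<integral>\<^sup>+ s. ennreal ((u + s) * g (q + (2 * u * s + s\<^sup>2) / d)) * indicator {0..} s \<partial>lborel)"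
proof -
  \<comment> \<open>The quadratic form along the ray. Its derivative 2 (u + s) / d accounts for the
    factor 1/2 in \<open>tail\<close>, and u \<ge> 0 makes it increasing for s \<ge> 0.\<close>
  define G where "G s = q + (2 * u * s + s\<^sup>2) / d" for s
  have G0: "G 0 = q" by (simp add: G_def)
  have [measurable]: "G \<in> borel_measurable borel" unfolding G_def by measurable
  have Gm: "s \<le> t \<Longrightarrow> 0 \<le> s \<Longrightarrow> G s \<le> G t" for s t
    using assms(3,4) unfolding G_def
    by (intro add_left_mono divide_right_mono add_mono mult_left_mono power_mono) auto
  have subst: "(\<integral>\<^sup>+ x. ennreal (d * g x / 2) * indicator {q..G m} x \<partial>lborel) =
    (\<integral>\<^sup>+ s. ennreal ((u + s) * g (G s)) * indicator {0..m} s \<partial>lborel)" if "0 \<le> m" for m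
  proof -
    have "(\<integral>\<^sup>+ x. ennreal (d * g x / 2 * indicator {G 0..G m} x) \<partial>lborel) =
      (\<integral>\<^sup>+ s. ennreal (d * g (G s) / 2 * (2 * (u + s) / d) * indicator {0..m} s) \<partial>lborel)"
    proof (rule nn_integral_substitution)
      show "(G has_real_derivative 2 * (u + x) / d) (at x)" for x
        unfolding G_def using assms(4) by (auto intro!: derivative_eq_intros simp: field_simps)
      show "continuous_on {0..m} (\<lambda>s. 2 * (u + s) / d)"
        using assms(4) by (intro continuous_intros) auto
    qed (use assms that in \<open>auto simp: set_borel_measurable_def\<close>)
    also have "\<dots> = (\<integral>\<^sup>+ s. ennreal ((u + s) * g (G s)) * indicator {0..m} s \<partial>lborel)"
    proof -
      have "d * g (G s) / 2 * (2 * (u + s) / d) = (u + s) * g (G s)" for s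
        using assms(4) by (simp add: field_simps)
      then show ?thesis by (auto intro!: nn_integral_cong split: split_indicator)
    qed
    finally show ?thesis
      by (simp add: G0 nn_integral_set_ennreal)
  qed
  have inc: "indicator {q..G (real m)} x \<le> (indicator {q..G (real n)} x :: ennreal)" if "m \<le> n" for m n x
    using Gm[of "real m" "real n"] that by (auto split: split_indicator)
  have "ennreal d * tail g q = (\<integral>\<^sup>+ x. ennreal (d * g x / 2) * indicator {q..} x \<partial>lborel)"
    unfolding tail_def using assms
    by (subst nn_integral_cmult[symmetric]) (auto simp: ennreal_mult''[symmetric] mult.assoc[symmetric])
  also have "\<dots> = (\<integral>\<^sup>+ x. (SUP m::nat. ennreal (d * g x / 2) * indicator {q..G m} x) \<partial>lborel)"
  proof (rule nn_integral_cong)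
    fix x
    \<comment> \<open>Since m \<le> m^2, the choice gives d |x - q| \<le> 2 u m + m^2, so the image
      of [0, m] reaches x.\<close>
    obtain m :: nat where m: "1 + d * \<bar>x - q\<bar> < m" using reals_Archimedean2 by blast
    have "m \<le> real m * m" using m by (cases m) auto
    then have "d * \<bar>x - q\<bar> \<le> 2 * u * m + (real m)\<^sup>2" using m assms(3)
      by (auto simp: power2_eq_square intro: add_increasing)
    then have "\<bar>x - q\<bar> \<le> (2 * u * m + (real m)\<^sup>2) / d" using assms(4) by (simp add: field_simps)
    then have Gm: "x \<le> G m" unfolding G_def by linarith
    show "ennreal (d * g x / 2) * indicator {q..} x = (SUP m::nat. ennreal (d * g x / 2) * indicator {q..G m} x)"
    proof (rule antisym)
      show "ennreal (d * g x / 2) * indicator {q..} x \<le> (SUP m::nat. ennreal (d * g x / 2) * indicator {q..G m} x)"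
        by (rule SUP_upper2[of m]) (use Gm in \<open>auto simp: indicator_def\<close>)
    qed (auto intro!: SUP_least split: split_indicator)
  qed
  also have "\<dots> = (SUP m::nat. \<integral>\<^sup>+ x. ennreal (d * g x / 2) * indicator {q..G m} x \<partial>lborel)"
    by (subst nn_integral_monotone_convergence_SUP)
      (auto simp: incseq_def le_fun_def intro!: mult_left_mono inc)
  also have "\<dots> = (SUP m::nat. \<integral>\<^sup>+ s. ennreal ((u + s) * g (G s)) * indicator {0..real m} s \<partial>lborel)"
    by (simp add: subst)
  also have "\<dots> = (\<integral>\<^sup>+ s. (SUP m::nat. ennreal ((u + s) * g (G s)) * indicator {0..real m} s) \<partial>lborel)"
    by (subst nn_integral_monotone_convergence_SUP)
      (auto simp: incseq_def le_fun_def intro!: mult_left_mono split: split_indicator)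
  also have "\<dots> = (\<integral>\<^sup>+ s. ennreal ((u + s) * g (G s)) * indicator {0..} s \<partial>lborel)"
  proof (rule nn_integral_cong)
    fix s :: real
    obtain m :: nat where m: "s < m" using reals_Archimedean2 by blast
    show "(SUP m::nat. ennreal ((u + s) * g (G s)) * indicator {0..real m} s) =
      ennreal ((u + s) * g (G s)) * indicator {0..} s"
    proof (rule antisym)
      show "ennreal ((u + s) * g (G s)) * indicator {0..} s \<le> (SUP m::nat. ennreal ((u + s) * g (G s)) * indicator {0..real m} s)"
        by (rule SUP_upper2[of m]) (use m in \<open>auto simp: indicator_def\<close>)
    qed (auto intro!: SUP_least split: split_indicator)
  qed
  finally show ?thesis unfolding G_def .
qed

text \<open>\<open>tail_substitution\<close> turns d times the tail at y into an integral over the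
  ray y + s b. After exchanging the integrals, the translation x = y + s b at fixed s leaves u x * g
  (Q x) times the integral of \<open>E\<close> over the segment from x back to the hyperplane u = 0.
  This is integration by parts with no derivative in it.\<close>

lemma nn_integral_half_space:
  fixes b :: "'a::euclidean_space" and u Q :: "'a \<Rightarrow> real" and E :: "'a \<Rightarrow> ennreal"
  assumes [measurable]: "g \<in> borel_measurable borel" "u \<in> borel_measurable borel"
      "Q \<in> borel_measurable borel" "E \<in> borel_measurable borel"
    and g: "\<And>t. 0 \<le> g t" and d: "0 < d"
    and u: "\<And>y s. u (y + s *\<^sub>R b) = u y + s"
    and Q: "\<And>y s. Q (y + s *\<^sub>R b) = Q y + (2 * u y * s + s\<^sup>2) / d"
  shows "ennreal d * (\<integral>\<^sup>+ y. E y * indicator {y. 0 < u y} y * tail g (Q y) \<partial>lborel) =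
    (\<integral>\<^sup>+ x. indicator {y. 0 < u y} x * ennreal (u x * g (Q x)) *
       (\<integral>\<^sup>+ s. E (x - s *\<^sub>R b) * indicator {0..<u x} s \<partial>lborel) \<partial>lborel)"
proof -
  \<comment> \<open>The condition s < u x says that x - s b lies in the half space; at x = y + s b
    it becomes 0 < u y, whatever s is.\<close>
  define \<Psi> where "\<Psi> = (\<lambda>(s::real, x). E (x - s *\<^sub>R b) * ennreal (u x * g (Q x)) * indicator {p. 0 \<le> fst p \<and> fst p < u (snd p)} (s, x))"
  have [measurable]: "(\<lambda>p::real \<times> 'a. snd p - fst p *\<^sub>R b) \<in> borel \<Otimes>\<^sub>M borel \<rightarrow>\<^sub>M borel"
    by measurable
  have \<Psi>[measurable]: "\<Psi> \<in> borel_measurable (borel \<Otimes>\<^sub>M borel)"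
    unfolding \<Psi>_def case_prod_beta by measurable
  have "ennreal d * (\<integral>\<^sup>+ y. E y * indicator {y. 0 < u y} y * tail g (Q y) \<partial>lborel) =
    (\<integral>\<^sup>+ y. E y * indicator {y. 0 < u y} y * (ennreal d * tail g (Q y)) \<partial>lborel)"
    by (subst nn_integral_cmult[symmetric]) (auto simp: mult_ac)
  also have "\<dots> = (\<integral>\<^sup>+ y. (\<integral>\<^sup>+ s. \<Psi> (s, y + s *\<^sub>R b) \<partial>lborel) \<partial>lborel)"
  proof (rule nn_integral_cong)
    fix y
    show "E y * indicator {y. 0 < u y} y * (ennreal d * tail g (Q y)) = (\<integral>\<^sup>+ s. \<Psi> (s, y + s *\<^sub>R b) \<partial>lborel)"
    proof (cases "0 < u y")
      case True
      have "(\<integral>\<^sup>+ s. \<Psi> (s, y + s *\<^sub>R b) \<partial>lborel) = (\<integral>\<^sup>+ s. E y * (ennreal ((u y + s) * g (Q y + (2 * u y * s + s\<^sup>2) / d)) * indicator {0..} s) \<partial>lborel)"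
        using True by (intro nn_integral_cong) (auto simp: \<Psi>_def u Q split: split_indicator)
      also have "\<dots> = E y * (ennreal d * tail g (Q y))"
        by (subst nn_integral_cmult) (use True g d in \<open>auto simp: tail_substitution[of g "u y" d]\<close>)
      finally show ?thesis using True by simp
    next
      case False
      then show ?thesis by (simp add: \<Psi>_def u)
    qed
  qed
  also have "\<dots> = (\<integral>\<^sup>+ s. (\<integral>\<^sup>+ y. \<Psi> (s, y + s *\<^sub>R b) \<partial>lborel) \<partial>lborel)"
    by (rule lborel_pair.Fubini') measurable
  also have "\<dots> = (\<integral>\<^sup>+ s. (\<integral>\<^sup>+ x. \<Psi> (s, x) \<partial>lborel) \<partial>lborel)"
    by (intro nn_integral_cong nn_integral_lborel_translate[where f="\<lambda>x. \<Psi> (_, x)"]) measurable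
  also have "\<dots> = (\<integral>\<^sup>+ x. (\<integral>\<^sup>+ s. \<Psi> (s, x) \<partial>lborel) \<partial>lborel)"
    by (rule lborel_pair.Fubini'[symmetric]) measurable
  also have "\<dots> = (\<integral>\<^sup>+ x. indicator {y. 0 < u y} x * ennreal (u x * g (Q x)) *
       (\<integral>\<^sup>+ s. E (x - s *\<^sub>R b) * indicator {0..<u x} s \<partial>lborel) \<partial>lborel)"
  proof (rule nn_integral_cong)
    fix x
    show "(\<integral>\<^sup>+ s. \<Psi> (s, x) \<partial>lborel) = indicator {y. 0 < u y} x * ennreal (u x * g (Q x)) *
       (\<integral>\<^sup>+ s. E (x - s *\<^sub>R b) * indicator {0..<u x} s \<partial>lborel)"
    proof (cases "0 < u x")
      case True
      have "(\<integral>\<^sup>+ s. \<Psi> (s, x) \<partial>lborel) = (\<integral>\<^sup>+ s. ennreal (u x * g (Q x)) * (E (x - s *\<^sub>R b) * indicator {0..<u x} s) \<partial>lborel)"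
        by (intro nn_integral_cong) (auto simp: \<Psi>_def mult_ac split: split_indicator)
      then show ?thesis using True by (simp add: nn_integral_cmult)
    next
      case False
      then have "\<Psi> (s, x) = 0" for s by (auto simp: \<Psi>_def)
      then show ?thesis using False by simp
    qed
  qed
  finally show ?thesis .
qed

text \<open>The exchange of integrals is available for nonnegative integrands only, so it is applied
  to \<open>E\<close> + K. The constant K contributes the same amount on both sides and cancels.
  \<open>D\<close> needs to dominate the segment integrals only almost everywhere, so an upper bound
  by an increment of an antiderivative will do.\<close>

lemma stein_half_space:
  fixes b :: "'a::euclidean_space" and u Q E D :: "'a \<Rightarrow> real" and g :: "real \<Rightarrow> real"
  defines "\<mu> \<equiv> density lborel (\<lambda>x. ennreal (g (Q x)))"
    and "\<nu> \<equiv> density lborel (\<lambda>x. tail g (Q x))"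
  assumes meas[measurable]: "g \<in> borel_measurable borel" "u \<in> borel_measurable borel"
      "Q \<in> borel_measurable borel" "E \<in> borel_measurable borel"
    and g: "\<And>t. 0 \<le> g t" and d: "0 < d"
    and u: "\<And>y s. u (y + s *\<^sub>R b) = u y + s"
    and Q: "\<And>y s. Q (y + s *\<^sub>R b) = Q y + (2 * u y * s + s\<^sup>2) / d"
    and E: "\<And>y. \<bar>E y\<bar> \<le> K"
    and fin: "finite_measure \<nu>"
    and D: "AE x in lborel. 0 < u x \<longrightarrow> (LINT s:{0..u x}|lborel. E (x - s *\<^sub>R b)) \<le> D x"
    and D_int: "integrable \<mu> (\<lambda>x. indicator {y. 0 < u y} x * (u x * D x))"
  shows "integrable \<nu> (\<lambda>y. indicator {y. 0 < u y} y * E y)"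
    and "d * (\<integral>y. indicator {y. 0 < u y} y * E y \<partial>\<nu>) \<le> (\<integral>x. indicator {y. 0 < u y} x * (u x * D x) \<partial>\<mu>)"
proof -
  let ?i = "indicator {y. 0 < u y} :: 'a \<Rightarrow> real"
  have [measurable_cong]: "sets \<mu> = sets borel" "sets \<nu> = sets borel" by (simp_all add: \<mu>_def \<nu>_def)
  have half: "ennreal d * (\<integral>\<^sup>+ y. e y * ennreal (?i y) \<partial>\<nu>) =
    (\<integral>\<^sup>+ x. ennreal (?i x * u x) * (\<integral>\<^sup>+ s. e (x - s *\<^sub>R b) * indicator {0..<u x} s \<partial>lborel) \<partial>\<mu>)"
    if [measurable]: "e \<in> borel_measurable borel" for e :: "'a \<Rightarrow> ennreal"
  proof -
    have [measurable]: "(\<lambda>p::'a \<times> real. fst p - snd p *\<^sub>R b) \<in> borel \<Otimes>\<^sub>M borel \<rightarrow>\<^sub>M borel"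
      by measurable
    have *: "(\<lambda>x. \<integral>\<^sup>+ s. e (x - s *\<^sub>R b) * indicator {0..<u x} s \<partial>lborel) =
      (\<lambda>x. \<integral>\<^sup>+ s. e (fst (x, s) - snd (x, s) *\<^sub>R b) * indicator {p. 0 \<le> snd p \<and> snd p < u (fst p)} (x, s) \<partial>lborel)"
      by (auto intro!: ext nn_integral_cong split: split_indicator)
    have [measurable]: "(\<lambda>x. \<integral>\<^sup>+ s. e (x - s *\<^sub>R b) * indicator {0..<u x} s \<partial>lborel) \<in> borel_measurable borel"
      unfolding * by measurable
    have "ennreal d * (\<integral>\<^sup>+ y. e y * ennreal (?i y) \<partial>\<nu>) =
        ennreal d * (\<integral>\<^sup>+ y. e y * indicator {y. 0 < u y} y * tail g (Q y) \<partial>lborel)"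
      unfolding \<nu>_def by (subst nn_integral_density) (auto simp: mult_ac ennreal_indicator)
    also have "\<dots> = (\<integral>\<^sup>+ x. indicator {y. 0 < u y} x * ennreal (u x * g (Q x)) *
       (\<integral>\<^sup>+ s. e (x - s *\<^sub>R b) * indicator {0..<u x} s \<partial>lborel) \<partial>lborel)"
      by (rule nn_integral_half_space[OF meas(1-3) that g d u Q])
    also have "\<dots> = (\<integral>\<^sup>+ x. ennreal (?i x * u x) * (\<integral>\<^sup>+ s. e (x - s *\<^sub>R b) * indicator {0..<u x} s \<partial>lborel) \<partial>\<mu>)"
      unfolding \<mu>_def
    proof (subst nn_integral_density)
      show "(\<integral>\<^sup>+ x. indicator {y. 0 < u y} x * ennreal (u x * g (Q x)) *
          (\<integral>\<^sup>+ s. e (x - s *\<^sub>R b) * indicator {0..<u x} s \<partial>lborel) \<partial>lborel) =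
        (\<integral>\<^sup>+ x. ennreal (g (Q x)) * (ennreal (?i x * u x) *
          (\<integral>\<^sup>+ s. e (x - s *\<^sub>R b) * indicator {0..<u x} s \<partial>lborel)) \<partial>lborel)"
        by (intro nn_integral_cong) (auto simp: ennreal_mult'' g mult_ac split: split_indicator)
    qed measurable
    finally show ?thesis .
  qed
  have "(\<integral>\<^sup>+ y. ennreal (?i y) \<partial>\<nu>) = emeasure \<nu> {y. 0 < u y}"
    by (simp add: ennreal_indicator)
  also have "\<dots> < \<infinity>"
    using finite_measure.emeasure_finite[OF fin] by (simp add: less_top)
  finally have fin1: "(\<integral>\<^sup>+ y. ennreal (?i y) \<partial>\<nu>) < \<infinity>" .
  \<comment> \<open>The identity for the constant function 1. It shows that the two contributions of
    K are equal, and that one side is finite because the other is.\<close>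
  have mass: "(\<integral>\<^sup>+ x. ennreal (?i x * (u x)\<^sup>2) \<partial>\<mu>) = ennreal d * (\<integral>\<^sup>+ y. ennreal (?i y) \<partial>\<nu>)"
  proof -
    have "ennreal d * (\<integral>\<^sup>+ y. ennreal (?i y) \<partial>\<nu>) =
        (\<integral>\<^sup>+ x. ennreal (?i x * u x) * (\<integral>\<^sup>+ s. indicator {0..<u x} s \<partial>lborel) \<partial>\<mu>)"
      using half[of "\<lambda>_. 1"] by simp
    also have "\<dots> = (\<integral>\<^sup>+ x. ennreal (?i x * (u x)\<^sup>2) \<partial>\<mu>)"
      by (intro nn_integral_cong) (auto split: split_indicator simp: ennreal_mult''[symmetric] power2_eq_square)
    finally show ?thesis ..
  qed
  have iu2: "integrable \<mu> (\<lambda>x. ?i x * (u x)\<^sup>2)"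
    by (rule integrableI_nonneg) (use fin1 mass in \<open>auto simp: ennreal_mult_less_top\<close>)
  define I where "I = (\<integral>x. ?i x * (u x)\<^sup>2 \<partial>\<mu>)"
  have mass_I: "ennreal d * (\<integral>\<^sup>+ y. ennreal (?i y) \<partial>\<nu>) = ennreal I"
    unfolding I_def mass[symmetric] by (rule nn_integral_eq_integral[OF iu2]) (auto split: split_indicator)
  have int1: "integrable \<nu> ?i"
    by (rule integrableI_nonneg) (use fin1 in auto)
  then show intE: "integrable \<nu> (\<lambda>y. ?i y * E y)"
    by (rule Bochner_Integration.integrable_bound[OF integrable_mult_left[where c=K]])
      (use E in \<open>auto split: split_indicator intro: order_trans[OF _ abs_ge_self]\<close>)
  have "0 \<le> I" unfolding I_def by (intro integral_nonneg_AE) auto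
  have I: "d * (\<integral>y. ?i y \<partial>\<nu>) = I"
  proof -
    have "ennreal (d * (\<integral>y. ?i y \<partial>\<nu>)) = ennreal d * (\<integral>\<^sup>+ y. ennreal (?i y) \<partial>\<nu>)"
      using d by (subst nn_integral_eq_integral[OF int1]) (auto simp: ennreal_mult')
    then show ?thesis using \<open>0 \<le> I\<close> d by (subst (asm) mass_I) (auto simp: ennreal_inj integral_nonneg_AE)
  qed
  have K: "0 \<le> K" using E[of undefined] by (rule order_trans[rotated]) simp
  have EK: "0 \<le> E y + K" for y using E[of y] by linarith
  have seg: "set_integrable lborel {0..u x} (\<lambda>s. E (x - s *\<^sub>R b) + K)"
    "0 < u x \<Longrightarrow> (LINT s:{0..u x}|lborel. E (x - s *\<^sub>R b) + K) = (LINT s:{0..u x}|lborel. E (x - s *\<^sub>R b)) + K * u x" for x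
  proof -
    have [measurable]: "(\<lambda>s. E (x - s *\<^sub>R b)) \<in> borel_measurable borel"
      by (rule measurable_compose[of _ _ borel]) measurable
    have c: "set_integrable lborel {0..u x} (\<lambda>s. K)"
      by (auto simp: set_integrable_def integrable_indicator_iff emeasure_lborel_Icc_eq)
    have e: "set_integrable lborel {0..u x} (\<lambda>s. E (x - s *\<^sub>R b))"
      unfolding set_integrable_def
      by (rule Bochner_Integration.integrable_bound[OF c[unfolded set_integrable_def]])
        (use E K in \<open>auto split: split_indicator\<close>)
    show "set_integrable lborel {0..u x} (\<lambda>s. E (x - s *\<^sub>R b) + K)"
      using set_integral_add(1)[OF e c] .
    show "(LINT s:{0..u x}|lborel. E (x - s *\<^sub>R b) + K) = (LINT s:{0..u x}|lborel. E (x - s *\<^sub>R b)) + K * u x" if "0 < u x"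
      using that by (subst set_integral_add(2)[OF e c]) (simp add: set_lebesgue_integral_def mult.commute)
  qed
  have D\<mu>: "AE x in \<mu>. 0 < u x \<longrightarrow> (LINT s:{0..u x}|lborel. E (x - s *\<^sub>R b)) \<le> D x"
    using D unfolding \<mu>_def by (subst AE_density) (auto elim!: eventually_mono)
  \<comment> \<open>Negative reals are truncated by \<open>ennreal\<close>, so this is needed to
    evaluate the upper bound as a real integral. It holds because the segment integral of
    \<open>E\<close> + K is nonnegative and at most D + K u.\<close>
  have pos: "AE x in \<mu>. 0 \<le> ?i x * (u x * D x) + K * (?i x * (u x)\<^sup>2)"
    using D\<mu>
  proof (rule eventually_mono)
    fix x assume *: "0 < u x \<longrightarrow> (LINT s:{0..u x}|lborel. E (x - s *\<^sub>R b)) \<le> D x"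
    show "0 \<le> ?i x * (u x * D x) + K * (?i x * (u x)\<^sup>2)"
    proof (cases "0 < u x")
      case True
      have "0 \<le> (LINT s:{0..u x}|lborel. E (x - s *\<^sub>R b) + K)"
        unfolding set_lebesgue_integral_def using EK by (intro integral_nonneg_AE) auto
      then have "0 \<le> D x + K * u x" using seg(2)[OF True] * True by simp
      then have "0 \<le> u x * (D x + K * u x)" using True by simp
      then show ?thesis using True by (simp add: power2_eq_square algebra_simps)
    qed simp
  qed
  have int2: "integrable \<nu> (\<lambda>y. ?i y * E y + K * ?i y)"
    using intE int1 by auto
  have "(\<integral>y. ?i y * E y + K * ?i y \<partial>\<nu>) = (\<integral>y. ?i y * E y \<partial>\<nu>) + (\<integral>y. K * ?i y \<partial>\<nu>)"
    using intE int1 by (intro Bochner_Integration.integral_add) auto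
  then have split: "(\<integral>y. ?i y * E y \<partial>\<nu>) + K * (\<integral>y. ?i y \<partial>\<nu>) = (\<integral>y. ?i y * E y + K * ?i y \<partial>\<nu>)"
    by (simp only: integral_mult_right_zero)
  have "ennreal (d * ((\<integral>y. ?i y * E y \<partial>\<nu>) + K * (\<integral>y. ?i y \<partial>\<nu>))) =
      ennreal d * ennreal (\<integral>y. ?i y * E y + K * ?i y \<partial>\<nu>)"
    using d unfolding split by (simp add: ennreal_mult')
  also have "\<dots> = ennreal d * (\<integral>\<^sup>+ y. ennreal (E y + K) * ennreal (?i y) \<partial>\<nu>)"
    using EK by (subst nn_integral_eq_integral[OF int2, symmetric])
      (auto intro!: nn_integral_cong arg_cong[where f="\<lambda>t. ennreal d * t"] split: split_indicator)
  also have "\<dots> = (\<integral>\<^sup>+ x. ennreal (?i x * u x) * (\<integral>\<^sup>+ s. ennreal (E (x - s *\<^sub>R b) + K) * indicator {0..<u x} s \<partial>lborel) \<partial>\<mu>)"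
    by (rule half) measurable
  also have "\<dots> \<le> (\<integral>\<^sup>+ x. ennreal (?i x * (u x * D x) + K * (?i x * (u x)\<^sup>2)) \<partial>\<mu>)"
  proof (rule nn_integral_mono_AE)
    show "AE x in \<mu>. ennreal (?i x * u x) * (\<integral>\<^sup>+ s. ennreal (E (x - s *\<^sub>R b) + K) * indicator {0..<u x} s \<partial>lborel)
        \<le> ennreal (?i x * (u x * D x) + K * (?i x * (u x)\<^sup>2))"
      using D\<mu>
    proof (rule eventually_mono)
      fix x assume D: "0 < u x \<longrightarrow> (LINT s:{0..u x}|lborel. E (x - s *\<^sub>R b)) \<le> D x"
      show "ennreal (?i x * u x) * (\<integral>\<^sup>+ s. ennreal (E (x - s *\<^sub>R b) + K) * indicator {0..<u x} s \<partial>lborel)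
        \<le> ennreal (?i x * (u x * D x) + K * (?i x * (u x)\<^sup>2))"
      proof (cases "0 < u x")
        case True
        have "(\<integral>\<^sup>+ s. ennreal (E (x - s *\<^sub>R b) + K) * indicator {0..<u x} s \<partial>lborel) \<le>
           (\<integral>\<^sup>+ s. ennreal (indicator {0..u x} s *\<^sub>R (E (x - s *\<^sub>R b) + K)) \<partial>lborel)"
          by (intro nn_integral_mono) (auto split: split_indicator)
        also have "\<dots> = ennreal ((LINT s:{0..u x}|lborel. E (x - s *\<^sub>R b)) + K * u x)"
          using seg(1)[of x] EK unfolding seg(2)[OF True, symmetric]
          unfolding set_lebesgue_integral_def set_integrable_def
          by (intro nn_integral_eq_integral) auto
        also have "\<dots> \<le> ennreal (D x + K * u x)"
          using D True by (intro ennreal_leI) auto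
        finally have "ennreal (u x) * (\<integral>\<^sup>+ s. ennreal (E (x - s *\<^sub>R b) + K) * indicator {0..<u x} s \<partial>lborel)
            \<le> ennreal (u x) * ennreal (D x + K * u x)"
          by (rule mult_left_mono) simp
        also have "\<dots> = ennreal (u x * D x + K * (u x)\<^sup>2)"
          using True by (simp add: ennreal_mult'[symmetric] power2_eq_square distrib_left mult_ac)
        finally show ?thesis using True by simp
      qed simp
    qed
  qed
  also have "\<dots> = ennreal ((\<integral>x. ?i x * (u x * D x) \<partial>\<mu>) + K * I)"
    unfolding I_def using D_int iu2 pos
    by (subst nn_integral_eq_integral) auto
  finally have fin_le: "ennreal (d * ((\<integral>y. ?i y * E y \<partial>\<nu>) + K * (\<integral>y. ?i y \<partial>\<nu>))) \<le> ennreal ((\<integral>x. ?i x * (u x * D x) \<partial>\<mu>) + K * I)" .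
  have I_nonneg: "0 \<le> (\<integral>x. ?i x * (u x * D x) \<partial>\<mu>) + K * I"
    using integral_nonneg_AE[OF pos] D_int iu2 by (simp add: I_def)
  \<comment> \<open>By \<open>I\<close> the terms with K on the two sides agree and are
    subtracted.\<close>
  show "d * (\<integral>y. ?i y * E y \<partial>\<nu>) \<le> (\<integral>x. ?i x * (u x * D x) \<partial>\<mu>)"
    using fin_le I by (subst (asm) ennreal_le_iff) (auto simp: distrib_left I_nonneg mult.left_commute[of d])
qed

lemma AE_lborel_inner_neq:
  fixes b :: "'a::euclidean_space"
  assumes "b \<in> Basis"
  shows "AE x in lborel. x \<bullet> b \<noteq> t"
proof -
  have "{x. x \<bullet> b = t} \<in> null_sets lebesgue"
    using negligible_standard_hyperplane[OF assms, of t] by (simp add: negligible_iff_null_sets)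
  then have "{x. x \<bullet> b = t} \<in> null_sets lborel"
    by (subst (asm) null_sets_completion_iff) auto
  then show ?thesis
    by (rule AE_I') auto
qed

text \<open>Reflection in the hyperplane x . b = t preserves Lebesgue measure, so the integral
  equals its own negative. If \<psi> is not integrable, the integral is 0 by convention.\<close>

lemma integral_odd_coordinate:
  fixes b :: "'a::euclidean_space" and \<psi> :: "'a \<Rightarrow> real"
  assumes b: "b \<in> Basis" and [measurable]: "\<psi> \<in> borel_measurable borel"
    and odd: "\<And>x. \<psi> (x - (2 * (x \<bullet> b - t)) *\<^sub>R b) = - \<psi> x"
  shows "(\<integral>x. \<psi> x \<partial>lborel) = 0"
proof -
  \<comment> \<open>The reflection is an affine map with diagonal linear part: entry -1 in direction
    b and 1 elsewhere, so its Jacobian has absolute value 1.\<close>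
  define c where "c j = (if j = b then - 1 else 1 :: real)" for j
  have T: "(2 * t) *\<^sub>R b + (\<Sum>j\<in>Basis. (c j * (x \<bullet> j)) *\<^sub>R j) = x - (2 * (x \<bullet> b - t)) *\<^sub>R b" for x
  proof -
    have "(\<Sum>j\<in>Basis. (c j * (x \<bullet> j)) *\<^sub>R j) = (\<Sum>j\<in>Basis. (x \<bullet> j) *\<^sub>R j - (if j = b then (2 * (x \<bullet> b)) *\<^sub>R b else 0))"
      by (intro sum.cong refl) (auto simp: c_def scaleR_left_diff_distrib[symmetric] simp del: scaleR_minus_left)
    also have "\<dots> = x - (2 * (x \<bullet> b)) *\<^sub>R b"
      using b by (simp add: sum_subtractf euclidean_representation)
    finally show ?thesis by (simp add: algebra_simps)
  qed
  have c_nz: "c j \<noteq> 0" for j by (simp add: c_def)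
  have "(\<Prod>j\<in>Basis. \<bar>c j\<bar>) = 1" by (intro prod.neutral) (auto simp: c_def)
  then have "(lborel :: 'a measure) = distr lborel borel (\<lambda>x. x - (2 * (x \<bullet> b - t)) *\<^sub>R b)"
    using lborel_affine_euclidean[of c "(2 * t) *\<^sub>R b"] c_nz by (simp add: T density_1)
  then have "(\<integral>x. \<psi> x \<partial>lborel) = (\<integral>x. \<psi> x \<partial>distr lborel borel (\<lambda>x. x - (2 * (x \<bullet> b - t)) *\<^sub>R b))"
    by simp
  also have "\<dots> = (\<integral>x. - \<psi> x \<partial>lborel)"
    unfolding odd[symmetric] by (rule integral_distr) measurable
  finally show ?thesis by simp
qed

text \<open>For the constant function 1 the half-space identity bounds the mass on either side of
  the hyperplane by a second moment of one coordinate, divided by d; the hyperplane itself is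
  null.\<close>

lemma finite_measure_tail:
  fixes b :: "'a::euclidean_space" and Q :: "'a \<Rightarrow> real" and g :: "real \<Rightarrow> real" and t :: real
  assumes meas[measurable]: "g \<in> borel_measurable borel" "Q \<in> borel_measurable borel"
    and b: "b \<in> Basis" and g: "\<And>t. 0 \<le> g t" and d: "0 < d"
    and Q: "\<And>y s. Q (y + s *\<^sub>R b) = Q y + (2 * (y \<bullet> b - t) * s + s\<^sup>2) / d"
    and int: "integrable (density lborel (\<lambda>x. ennreal (g (Q x)))) (\<lambda>x. (x \<bullet> b - t)\<^sup>2)"
  shows "finite_measure (density lborel (\<lambda>x. tail g (Q x)))"
proof (rule finite_measureI)
  have [simp]: "b \<bullet> b = 1" using b by simp
  have fin: "(\<integral>\<^sup>+ x. ennreal (g (Q x)) * ennreal ((x \<bullet> b - t)\<^sup>2) \<partial>lborel) < \<infinity>"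
    using int by (simp add: integrable_iff_bounded nn_integral_density)
  have half: "(\<integral>\<^sup>+ y. indicator {y. 0 < u y} y * tail g (Q y) \<partial>lborel) < \<infinity>"
    if [measurable]: "u \<in> borel_measurable borel"
      and u: "\<And>y s. u (y + s *\<^sub>R e) = u y + s"
      and Qe: "\<And>y s. Q (y + s *\<^sub>R e) = Q y + (2 * u y * s + s\<^sup>2) / d"
      and u2: "\<And>x. (u x)\<^sup>2 = (x \<bullet> b - t)\<^sup>2" for u e
  proof -
    have "ennreal d * (\<integral>\<^sup>+ y. 1 * indicator {y. 0 < u y} y * tail g (Q y) \<partial>lborel) =
      (\<integral>\<^sup>+ x. indicator {y. 0 < u y} x * ennreal (u x * g (Q x)) *
         (\<integral>\<^sup>+ s. 1 * indicator {0..<u x} s \<partial>lborel) \<partial>lborel)"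
      by (rule nn_integral_half_space) (use g d u Qe in auto)
    also have "\<dots> \<le> (\<integral>\<^sup>+ x. ennreal (g (Q x)) * ennreal ((x \<bullet> b - t)\<^sup>2) \<partial>lborel)"
      unfolding u2[symmetric]
      by (intro nn_integral_mono)
        (auto simp: ennreal_mult''[symmetric] g power2_eq_square mult_ac split: split_indicator)
    finally have "ennreal d * (\<integral>\<^sup>+ y. 1 * indicator {y. 0 < u y} y * tail g (Q y) \<partial>lborel) < \<infinity>"
      using fin by (rule le_less_trans)
    then show ?thesis using d by (auto simp: ennreal_mult_less_top)
  qed
  have "AE y in lborel. tail g (Q y) = indicator {y. 0 < y \<bullet> b - t} y * tail g (Q y)
      + indicator {y. 0 < - (y \<bullet> b - t)} y * tail g (Q y)"
    using AE_lborel_inner_neq[OF b, of t] by (auto elim!: eventually_mono split: split_indicator)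
  then have "(\<integral>\<^sup>+ y. tail g (Q y) \<partial>lborel) = (\<integral>\<^sup>+ y. indicator {y. 0 < y \<bullet> b - t} y * tail g (Q y)
      + indicator {y. 0 < - (y \<bullet> b - t)} y * tail g (Q y) \<partial>lborel)"
    by (rule nn_integral_cong_AE)
  also have "\<dots> = (\<integral>\<^sup>+ y. indicator {y. 0 < y \<bullet> b - t} y * tail g (Q y) \<partial>lborel)
      + (\<integral>\<^sup>+ y. indicator {y. 0 < - (y \<bullet> b - t)} y * tail g (Q y) \<partial>lborel)"
    by (rule nn_integral_add) measurable
  also have "\<dots> < \<infinity>"
  proof -
    have "Q (y + s *\<^sub>R - b) = Q y + (2 * - (y \<bullet> b - t) * s + s\<^sup>2) / d" for y s
    proof -
      have eq: "2 * (y \<bullet> b - t) * - s + (- s)\<^sup>2 = 2 * - (y \<bullet> b - t) * s + s\<^sup>2"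
        by (simp add: algebra_simps)
      show ?thesis
        using Q[of y "- s"] unfolding eq by (simp only: scaleR_minus_left scaleR_minus_right)
    qed
    then show ?thesis
      using half[of "\<lambda>y. y \<bullet> b - t" b] half[of "\<lambda>y. - (y \<bullet> b - t)" "- b"] Q
      by (simp add: inner_add_left inner_diff_left power2_commute[of t])
  qed
  finally show "emeasure (density lborel (\<lambda>x. tail g (Q x))) (space (density lborel (\<lambda>x. tail g (Q x)))) \<noteq> \<infinity>"
    by (simp add: emeasure_density)
qed

text \<open>The half-space estimates in directions b and -b add up to a bound by the integral of u x
  * (G x - G (x - u x b)). The subtracted part is odd under reflection in the hyperplane u = 0 and
  disappears.\<close>

lemma stein_inequality:
  fixes b :: "'a::euclidean_space" and Q E G :: "'a \<Rightarrow> real" and g :: "real \<Rightarrow> real" and t :: real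
  defines "\<mu> \<equiv> density lborel (\<lambda>x. ennreal (g (Q x)))"
    and "\<nu> \<equiv> density lborel (\<lambda>x. tail g (Q x))"
    and "u \<equiv> \<lambda>x. x \<bullet> b - t"
  assumes meas[measurable]: "g \<in> borel_measurable borel" 
      "Q \<in> borel_measurable borel" "E \<in> borel_measurable borel" "G \<in> borel_measurable borel"
    and b: "b \<in> Basis" and g: "\<And>t. 0 \<le> g t" and d: "0 < d"
    and Q: "\<And>y s. Q (y + s *\<^sub>R b) = Q y + (2 * u y * s + s\<^sup>2) / d"
    and E: "\<And>y. \<bar>E y\<bar> \<le> K"
    and fin: "finite_measure \<nu>"
    and up: "AE x in lborel. 0 < u x \<longrightarrow>
       (LINT s:{0..u x}|lborel. E (x - s *\<^sub>R b)) \<le> G x - G (x - u x *\<^sub>R b)"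
    and down: "AE x in lborel. u x < 0 \<longrightarrow>
       (LINT s:{0..- u x}|lborel. E (x + s *\<^sub>R b)) \<le> G (x - u x *\<^sub>R b) - G x"
    and int: "integrable \<mu> (\<lambda>x. u x * G x)" "integrable \<mu> (\<lambda>x. u x * G (x - u x *\<^sub>R b))"
  shows "d * (\<integral>y. E y \<partial>\<nu>) \<le> (\<integral>x. u x * G x \<partial>\<mu>)"
proof -
  have [simp]: "b \<bullet> b = 1" using b by simp
  have [measurable_cong]: "sets \<mu> = sets borel" "sets \<nu> = sets borel" by (simp_all add: \<mu>_def \<nu>_def)
  have [measurable]: "u \<in> borel_measurable borel" unfolding u_def by measurable
  have [measurable]: "(\<lambda>x. G (x - u x *\<^sub>R b)) \<in> borel_measurable borel"
    by (rule measurable_compose[of _ _ borel]) measurable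
  \<comment> \<open>One integrand serves both half spaces: the outward distance and the outward
    increment change sign together.\<close>
  define R where "R x = u x * G x - u x * G (x - u x *\<^sub>R b)" for x
  have R: "integrable \<mu> R" unfolding R_def by (intro Bochner_Integration.integrable_diff int)
  have R_half: "integrable \<mu> (\<lambda>x. indicator {y. 0 < u y} x * R x)"
     "integrable \<mu> (\<lambda>x. indicator {y. 0 < - u y} x * R x)"
    by (rule Bochner_Integration.integrable_bound[OF R]; auto split: split_indicator simp: R_def)+
  have eq1: "indicator {y. 0 < u y} x * (u x * (G x - G (x - u x *\<^sub>R b))) = indicator {y. 0 < u y} x * R x"
   and eq2: "indicator {y. 0 < - u y} x * (- u x * (G (x - u x *\<^sub>R b) - G x)) = indicator {y. 0 < - u y} x * R x" for x
    by (auto simp: R_def algebra_simps)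
  note stein_up = stein_half_space[where b=b and u=u and Q=Q and E=E and g=g and d=d and K=K
      and D="\<lambda>x. G x - G (x - u x *\<^sub>R b)", folded \<mu>_def \<nu>_def, unfolded eq1]
  have up': "integrable \<nu> (\<lambda>y. indicator {y. 0 < u y} y * E y)"
     "d * (\<integral>y. indicator {y. 0 < u y} y * E y \<partial>\<nu>) \<le> (\<integral>x. indicator {y. 0 < u y} x * R x \<partial>\<mu>)"
    by (rule stein_up; use g d Q E fin up R_half in \<open>simp add: u_def inner_add_left\<close>)+
  note stein_down = stein_half_space[where b="- b" and u="\<lambda>x. - u x" and Q=Q and E=E and g=g and d=d and K=K
      and D="\<lambda>x. G (x - u x *\<^sub>R b) - G x", folded \<mu>_def \<nu>_def, unfolded eq2]
  have Q': "Q (y + s *\<^sub>R - b) = Q y + (2 * - u y * s + s\<^sup>2) / d" for y s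
    using Q[of y "- s"] by simp
  have down': "integrable \<nu> (\<lambda>y. indicator {y. 0 < - u y} y * E y)"
     "d * (\<integral>y. indicator {y. 0 < - u y} y * E y \<partial>\<nu>) \<le> (\<integral>x. indicator {y. 0 < - u y} x * R x \<partial>\<mu>)"
    by (rule stein_down; (rule Q')?; use g d E fin down R_half in \<open>simp add: u_def inner_diff_left\<close>)+
  have "AE x in lborel. u x \<noteq> 0"
    using AE_lborel_inner_neq[OF b, of t] by (auto simp: u_def elim!: eventually_mono)
  then have nz: "AE x in \<nu>. u x \<noteq> 0"
    unfolding \<nu>_def by (subst AE_density) (auto elim!: eventually_mono)
  have "(\<integral>y. E y \<partial>\<nu>) = (\<integral>y. indicator {y. 0 < u y} y * E y + indicator {y. 0 < - u y} y * E y \<partial>\<nu>)"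
    by (rule integral_cong_AE) (use nz in \<open>auto elim!: eventually_mono split: split_indicator\<close>)
  also have "d * \<dots> = d * (\<integral>y. indicator {y. 0 < u y} y * E y \<partial>\<nu>) + d * (\<integral>y. indicator {y. 0 < - u y} y * E y \<partial>\<nu>)"
    using up' down' by (simp add: distrib_left)
  also have "\<dots> \<le> (\<integral>x. indicator {y. 0 < u y} x * R x \<partial>\<mu>) + (\<integral>x. indicator {y. 0 < - u y} x * R x \<partial>\<mu>)"
    by (intro add_mono up' down')
  also have "\<dots> = (\<integral>x. indicator {y. 0 < u y} x * R x + indicator {y. 0 < - u y} x * R x \<partial>\<mu>)"
    using R_half by simp
  also have "\<dots> = (\<integral>x. R x \<partial>\<mu>)"
    by (intro Bochner_Integration.integral_cong) (auto split: split_indicator simp: R_def)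
  also have "\<dots> = (\<integral>x. u x * G x \<partial>\<mu>) - (\<integral>x. u x * G (x - u x *\<^sub>R b) \<partial>\<mu>)"
    unfolding R_def using int by simp
  also have "(\<integral>x. u x * G (x - u x *\<^sub>R b) \<partial>\<mu>) = (\<integral>x. g (Q x) * (u x * G (x - u x *\<^sub>R b)) \<partial>lborel)"
    unfolding \<mu>_def using g by (subst integral_density) auto
  also have "\<dots> = 0"
  \<comment> \<open>The reflection fixes both the foot point x - u b and the value of Q, and negates
    u.\<close>
  proof (rule integral_odd_coordinate[OF b])
    fix x
    let ?x = "x - (2 * (x \<bullet> b - t)) *\<^sub>R b"
    have 1: "u ?x = - u x" by (simp add: u_def inner_diff_left)
    have 0: "(2 * (x \<bullet> b - t)) *\<^sub>R b = u x *\<^sub>R b + u x *\<^sub>R b"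
      unfolding scaleR_left_distrib[symmetric] by (simp add: u_def)
    have 2: "?x - u ?x *\<^sub>R b = x - u x *\<^sub>R b"
      unfolding 1 unfolding 0 by (simp add: algebra_simps)
    have neg: "(- 2 * u x) *\<^sub>R b = - (u x *\<^sub>R b + u x *\<^sub>R b)"
      unfolding scaleR_left_distrib[symmetric] by (simp flip: scaleR_minus_left)
    have "Q ?x = Q (x + (- 2 * u x) *\<^sub>R b)"
      unfolding 0 neg by (simp only: diff_conv_add_uminus)
    also have "\<dots> = Q x" unfolding Q by (simp add: power2_eq_square)
    finally have 3: "Q ?x = Q x" .
    show "g (Q ?x) * (u ?x * G (?x - u ?x *\<^sub>R b)) = - (g (Q x) * (u x * G (x - u x *\<^sub>R b)))"
      unfolding 2 unfolding 3 1 by simp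
  qed measurable
  finally show "d * (\<integral>y. E y \<partial>\<nu>) \<le> (\<integral>x. u x * G x \<partial>\<mu>)" by simp
qed

section \<open>Risk of the shrinkage estimator\<close>

lemma nondecreasing_on_positives:
  fixes \<phi> \<phi>' :: "real \<Rightarrow> real"
  assumes "\<And>w. 0 < w \<Longrightarrow> (\<phi> has_real_derivative \<phi>' w) (at w)" "\<And>w. 0 < w \<Longrightarrow> 0 \<le> \<phi>' w"
    and "0 < x" "x \<le> y"
  shows "\<phi> x \<le> \<phi> y"
  by (rule DERIV_nonneg_imp_nondecreasing[OF \<open>x \<le> y\<close>]) (use assms in \<open>meson less_le_trans\<close>)

text \<open>Integrability of H' is not known in advance. The gauge integral of a derivative exists
  by the fundamental theorem, so the comparison with the continuous function e takes place
  there.\<close>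

lemma set_integral_le_increment:
  fixes e H H' :: "real \<Rightarrow> real"
  assumes "0 \<le> u" and e: "continuous_on {0..u} e"
    and H: "\<And>s. s \<in> {0..u} \<Longrightarrow> (H has_real_derivative H' s) (at s)"
    and le: "\<And>s. s \<in> {0..u} \<Longrightarrow> e s \<le> H' s"
  shows "(LINT s:{0..u}|lborel. e s) \<le> H u - H 0"
proof -
  have "set_integrable lborel {0..u} e"
    using e borel_integrable_compact[of "{0..u}" e] by (simp add: set_integrable_def)
  then have "(LINT s:{0..u}|lborel. e s) = integral {0..u} e"
    by (rule set_borel_integral_eq_integral)
  moreover have "(e has_integral integral {0..u} e) {0..u}"
    by (rule integrable_integral[OF integrable_continuous_interval[OF e]])
  moreover have "(H' has_integral H u - H 0) {0..u}"
    by (rule fundamental_theorem_of_calculus[OF \<open>0 \<le> u\<close>])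
      (use H in \<open>auto simp: has_real_derivative_iff_has_vector_derivative[symmetric] intro: has_field_derivative_at_within\<close>)
  ultimately show ?thesis
    using has_integral_le[of e _ "{0..u}" H' "H u - H 0"] le by simp
qed

text \<open>The derivative of x * r x is the integrand plus phi' times 2 a x^2 / (\<alpha> + a x^2),
  a nonnegative term that is dropped. Here \<alpha> collects the other coordinates and \<kappa> is a
  sign, so one statement serves both directions of the line.\<close>

lemma shrinkage_segment:
  fixes \<phi> \<phi>' :: "real \<Rightarrow> real" and a \<alpha> S y \<kappa> u :: real
  assumes deriv: "\<And>w. 0 < w \<Longrightarrow> (\<phi> has_real_derivative \<phi>' w) (at w)"
    and mono: "\<And>w. 0 < w \<Longrightarrow> 0 \<le> \<phi>' w"
    and a: "0 < a" and \<alpha>: "0 < \<alpha>" and S: "0 < S" and \<kappa>: "\<kappa>\<^sup>2 = 1" and u: "0 \<le> u"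
  defines "r \<equiv> \<lambda>x. \<phi> ((\<alpha> + a * x\<^sup>2) / S) / ((\<alpha> + a * x\<^sup>2) / S)"
  shows "(LINT s:{0..u}|lborel. r (y + \<kappa> * s) * (1 - 2 * a * (y + \<kappa> * s)\<^sup>2 / (\<alpha> + a * (y + \<kappa> * s)\<^sup>2)))
     \<le> \<kappa> * ((y + \<kappa> * u) * r (y + \<kappa> * u) - y * r y)"
proof -
  define A where "A x = \<alpha> + a * x\<^sup>2" for x
  have A: "0 < A x" for x unfolding A_def using a \<alpha> by (intro add_pos_nonneg) auto
  have A_deriv: "(A has_real_derivative 2 * a * x) (at x)" for x
    unfolding A_def by (auto intro!: derivative_eq_intros)
  define e where "e x = r x * (1 - 2 * a * x\<^sup>2 / A x)" for x
  have r_eq: "r x = \<phi> (A x / S) * S / A x" for x by (simp add: r_def A_def)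
  have cont: "continuous_on UNIV e"
  proof -
    have "isCont (\<lambda>x. \<phi> (A x / S)) x" for x
      by (rule isCont_o2[OF _ DERIV_isCont[OF deriv]])
        (use A S in \<open>auto intro!: continuous_intros DERIV_isCont[OF A_deriv]\<close>)
    then have "isCont e x" for x
      unfolding e_def r_eq using A[of x] by (intro continuous_intros DERIV_isCont[OF A_deriv]) auto
    then show ?thesis by (simp add: continuous_at_imp_continuous_on)
  qed
  have G: "((\<lambda>x. x * r x) has_real_derivative e x + \<phi>' (A x / S) * (2 * a * x\<^sup>2 / A x)) (at x)" for x
  proof -
    have "((\<lambda>x. \<phi> (A x / S)) has_real_derivative \<phi>' (A x / S) * (2 * a * x / S)) (at x)"
      by (rule DERIV_chain2[OF deriv]) (use A S in \<open>auto intro!: derivative_eq_intros A_deriv\<close>)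
    then show ?thesis
      unfolding e_def r_eq using A[of x] S
      by (auto intro!: derivative_eq_intros A_deriv) (simp add: field_simps power2_eq_square)
  qed
  have "(LINT s:{0..u}|lborel. e (y + \<kappa> * s)) \<le> \<kappa> * ((y + \<kappa> * u) * r (y + \<kappa> * u)) - \<kappa> * ((y + \<kappa> * 0) * r (y + \<kappa> * 0))"
  proof (rule set_integral_le_increment[OF u])
    show "continuous_on {0..u} (\<lambda>s. e (y + \<kappa> * s))"
      by (rule continuous_on_compose2[OF cont]) (auto intro!: continuous_intros)
    let ?d = "\<lambda>x. e x + \<phi>' (A x / S) * (2 * a * x\<^sup>2 / A x)"
    have "((\<lambda>s. \<kappa> * ((y + \<kappa> * s) * r (y + \<kappa> * s))) has_real_derivative \<kappa> * (?d (y + \<kappa> * s) * \<kappa>)) (at s)" for s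
      by (intro DERIV_cmult DERIV_chain2[OF G]) (auto intro!: derivative_eq_intros)
    moreover have "\<kappa> * (z * \<kappa>) = z" for z using \<kappa> by (simp add: power2_eq_square mult.left_commute)
    ultimately show "((\<lambda>s. \<kappa> * ((y + \<kappa> * s) * r (y + \<kappa> * s))) has_real_derivative ?d (y + \<kappa> * s)) (at s)" for s
      by simp
    show "e (y + \<kappa> * s) \<le> ?d (y + \<kappa> * s)" for s
      using A[of "y + \<kappa> * s"] mono[of "A (y + \<kappa> * s) / S"] a S by simp
  qed
  then show ?thesis by (simp add: e_def A_def right_diff_distrib)
qed

text \<open>Monotonicity of phi replaces differentiation. Towards the hyperplane the argument of phi
  grows, so phi is at least its value p at s = 0; with p in its place the integral is a polynomial
  that equals the left-hand side.\<close>

lemma noise_segment: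
  fixes \<phi> :: "real \<Rightarrow> real" and A \<beta> \<sigma> u :: real
  assumes mono: "\<And>v w. 0 < v \<Longrightarrow> v \<le> w \<Longrightarrow> \<phi> v \<le> \<phi> w"
    and \<phi>: "\<And>w. 0 < w \<Longrightarrow> 0 \<le> \<phi> w"
    and A: "0 < A" and \<beta>: "0 \<le> \<beta>" and \<sigma>: "0 \<le> \<sigma>" and u: "0 < u"
    and int: "set_integrable lborel {0..u} 
        (\<lambda>s. \<phi> (A / (\<sigma> + (u - s)\<^sup>2)) * (\<phi> (A / (\<sigma> + (u - s)\<^sup>2)) / (A / (\<sigma> + (u - s)\<^sup>2))) * \<beta> *
          (1 + 2 * (u - s)\<^sup>2 / (\<sigma> + (u - s)\<^sup>2)))"
  shows "u * (\<phi> (A / (\<sigma> + u\<^sup>2)) * (\<phi> (A / (\<sigma> + u\<^sup>2)) / (A / (\<sigma> + u\<^sup>2))) * \<beta>) \<le>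
    (LINT s:{0..u}|lborel. \<phi> (A / (\<sigma> + (u - s)\<^sup>2)) * (\<phi> (A / (\<sigma> + (u - s)\<^sup>2)) / (A / (\<sigma> + (u - s)\<^sup>2))) * \<beta> *
          (1 + 2 * (u - s)\<^sup>2 / (\<sigma> + (u - s)\<^sup>2)))"
    (is "_ \<le> (LINT s:{0..u}|lborel. ?e s)")
proof -
  define p where "p = \<phi> (A / (\<sigma> + u\<^sup>2))"
  let ?f = "\<lambda>t. \<phi> (A / (\<sigma> + t\<^sup>2)) * (\<phi> (A / (\<sigma> + t\<^sup>2)) / (A / (\<sigma> + t\<^sup>2))) * \<beta> *
    (1 + 2 * t\<^sup>2 / (\<sigma> + t\<^sup>2))"
  \<comment> \<open>With t = u - s, the factor \<sigma> + 3 t^2 is both (\<sigma> + t^2) (1 + 2 t^2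
    / (\<sigma> + t^2)) and the t-derivative of \<sigma> t + t^3.\<close>
  let ?q = "\<lambda>s. p\<^sup>2 * \<beta> / A * (\<sigma> + 3 * (u - s)\<^sup>2)"
  have p: "0 \<le> p" unfolding p_def using A \<sigma> u by (intro \<phi> divide_pos_pos add_nonneg_pos) auto
  have cont: "continuous_on {0..u} ?q" by (intro continuous_intros)
  have q_int: "set_integrable lborel {0..u} ?q"
    using cont borel_integrable_compact[of "{0..u}" ?q] by (simp add: set_integrable_def)
  have "(?q has_integral (- p\<^sup>2 * \<beta> / A * (\<sigma> * (u - u) + (u - u)^3)) - (- p\<^sup>2 * \<beta> / A * (\<sigma> * (u - 0) + (u - 0)^3))) {0..u}"
    using u A by (intro fundamental_theorem_of_calculus)
      (auto simp: has_real_derivative_iff_has_vector_derivative[symmetric] field_simps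
        intro!: derivative_eq_intros)
  then have q': "integral {0..u} ?q = p\<^sup>2 * \<beta> / A * (\<sigma> * u + u ^ 3)"
    by (subst integral_unique) auto
  have q: "(LINT s:{0..u}|lborel. ?q s) = p\<^sup>2 * \<beta> / A * (\<sigma> * u + u ^ 3)"
    by (rule trans[OF set_borel_integral_eq_integral(2)[OF q_int] q'])
  have "u * (p * (p / (A / (\<sigma> + u\<^sup>2))) * \<beta>) = p\<^sup>2 * \<beta> / A * (\<sigma> * u + u ^ 3)"
    using A by (simp add: power2_eq_square power3_eq_cube field_simps)
  also have "\<dots> \<le> (LINT s:{0..u}|lborel. ?e s)"
    unfolding q[symmetric]
  proof (rule set_integral_mono[OF q_int int])
    fix s assume s: "s \<in> {0..u}"
    define t where "t = u - s"
    show "p\<^sup>2 * \<beta> / A * (\<sigma> + 3 * (u - s)\<^sup>2) \<le> ?e s"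
      unfolding t_def[symmetric]
    proof (cases "\<sigma> + t\<^sup>2 = 0")
      case True
      then have "\<sigma> = 0" "t = 0" using \<sigma> by (auto simp: add_nonneg_eq_0_iff)
      \<comment> \<open>Division by zero yields 0, so both sides vanish at this single point of the
        segment.\<close>
      then show "p\<^sup>2 * \<beta> / A * (\<sigma> + 3 * t\<^sup>2) \<le> ?f t" by simp
    next
      case False
      then have pos: "0 < \<sigma> + t\<^sup>2" using \<sigma> by (simp add: add_nonneg_nonneg less_le)
      have "t\<^sup>2 \<le> u\<^sup>2" using s by (intro power_mono) (auto simp: t_def)
      then have "p \<le> \<phi> (A / (\<sigma> + t\<^sup>2))" unfolding p_def
        using pos A by (intro mono divide_left_mono mult_pos_pos divide_pos_pos) auto
      then have "p\<^sup>2 \<le> (\<phi> (A / (\<sigma> + t\<^sup>2)))\<^sup>2" using p by (rule power_mono)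
      then have "p\<^sup>2 * (\<beta> / A * (\<sigma> + 3 * t\<^sup>2)) \<le> (\<phi> (A / (\<sigma> + t\<^sup>2)))\<^sup>2 * (\<beta> / A * (\<sigma> + 3 * t\<^sup>2))"
        using A \<beta> \<sigma> by (intro mult_right_mono) auto
      also have "\<dots> = ?f t"
      proof -
        have "z\<^sup>2 * (\<beta> / A * (\<sigma> + 3 * t\<^sup>2)) = z * (z / (A / (\<sigma> + t\<^sup>2))) * \<beta> * (1 + 2 * t\<^sup>2 / (\<sigma> + t\<^sup>2))" for z
        proof -
          have "z * (z / (A / (\<sigma> + t\<^sup>2))) * \<beta> * (1 + 2 * t\<^sup>2 / (\<sigma> + t\<^sup>2)) =
             z\<^sup>2 * \<beta> / A * ((\<sigma> + t\<^sup>2) * (1 + 2 * t\<^sup>2 / (\<sigma> + t\<^sup>2)))"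
            by (simp add: power2_eq_square)
          also have "(\<sigma> + t\<^sup>2) * (1 + 2 * t\<^sup>2 / (\<sigma> + t\<^sup>2)) = \<sigma> + 3 * t\<^sup>2"
            using pos by (simp add: distrib_left)
          finally have e: "z * (z / (A / (\<sigma> + t\<^sup>2))) * \<beta> * (1 + 2 * t\<^sup>2 / (\<sigma> + t\<^sup>2)) =
             z\<^sup>2 * \<beta> / A * (\<sigma> + 3 * t\<^sup>2)" .
          show ?thesis unfolding e by simp
        qed
        then show ?thesis .
      qed
      finally show "p\<^sup>2 * \<beta> / A * (\<sigma> + 3 * t\<^sup>2) \<le> ?f t" by (simp add: mult.assoc)
    qed
  qed
  finally show ?thesis unfolding p_def .
qed

lemma bounded_set_integrable:
  fixes e :: "real \<Rightarrow> real"
  assumes [measurable]: "e \<in> borel_measurable borel" and e: "\<And>s. \<bar>e s\<bar> \<le> K"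
  shows "set_integrable lborel {0..u} e"
proof -
  have "integrable lborel (\<lambda>s. indicator {0..u} s *\<^sub>R K)"
    by (auto simp: integrable_indicator_iff emeasure_lborel_Icc_eq)
  then show ?thesis unfolding set_integrable_def
    by (rule Bochner_Integration.integrable_bound)
      (use e in \<open>auto split: split_indicator intro: order_trans[OF _ abs_ge_self]\<close>)
qed

text \<open>One value of the parameter is fixed, with the scale and the normalizing constants
  absorbed into \<open>g\<close>, so that \<mu> is the sampling distribution and \<nu> its
  counterpart with \<open>g\<close> replaced by its tail. \<open>v\<close> bounds phi(w)/w,
  \<open>L\<close> bounds phi, and \<open>m\<close> bounds the weights; \<open>weight_sum\<close> is
  the form in which the bound by u_+ enters.\<close>

locale shrinkage =
  fixes d c \<theta> :: "real^'p" and j L v m :: real and \<phi> \<phi>' g :: "real \<Rightarrow> real"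
    and Q :: "(real^'p) \<times> (real^'n) \<Rightarrow> real" and \<mu> \<nu> :: "((real^'p) \<times> (real^'n)) measure"
  assumes d: "\<And>i. 0 < d $ i" and c: "\<And>i. 0 < c $ i" and card: "CARD('p) \<ge> 2"
    and g_meas[measurable]: "g \<in> borel_measurable borel" and g: "\<And>t. 0 \<le> g t"
    and \<phi>_deriv: "\<And>w. 0 < w \<Longrightarrow> (\<phi> has_real_derivative \<phi>' w) (at w)"
    and \<phi>': "\<And>w. 0 < w \<Longrightarrow> 0 \<le> \<phi>' w"
    and \<phi>_nonneg: "\<And>w. 0 < w \<Longrightarrow> 0 \<le> \<phi> w"
    and \<phi>_quotient: "\<And>w. 0 < w \<Longrightarrow> \<phi> w / w \<le> v"
    and \<phi>_le: "\<And>w. 0 < w \<Longrightarrow> \<phi> w \<le> L"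
    and weight_le: "\<And>i. d $ i powr (1 - j) / c $ i \<le> m"
    and weight_sum: "(4 + (real CARD('n) + 2) * L) * m \<le> 2 * (\<Sum>i\<in>UNIV. d $ i powr (1 - j) / c $ i)"
    and Q_def: "Q = (\<lambda>y. (\<Sum>i\<in>UNIV. (fst y $ i - \<theta> $ i)\<^sup>2 / d $ i) + snd y \<bullet> snd y)"
    and \<mu>_def: "\<mu> = density lborel (\<lambda>y. ennreal (g (Q y)))"
    and \<nu>_def: "\<nu> = density lborel (\<lambda>y. tail g (Q y))"
    and \<mu>_finite: "finite_measure \<mu>"
    and second_moment: "\<And>i. integrable \<mu> (\<lambda>y. (fst y $ i)\<^sup>2)"
begin

definition A :: "(real^'p) \<times> (real^'n) \<Rightarrow> real" where "A y = (\<Sum>i\<in>UNIV. (fst y $ i)\<^sup>2 / (c $ i * d $ i))"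
definition B :: "(real^'p) \<times> (real^'n) \<Rightarrow> real" where "B y = (\<Sum>i\<in>UNIV. d $ i powr (- j) / (c $ i)\<^sup>2 * (fst y $ i)\<^sup>2)"
definition S :: "(real^'p) \<times> (real^'n) \<Rightarrow> real" where "S y = snd y \<bullet> snd y"
definition W :: "(real^'p) \<times> (real^'n) \<Rightarrow> real" where "W y = A y / S y"
text \<open>
  \<open>W y\<close> is 0 also when \<open>S y = 0\<close>; there the quotient \<open>\<phi> 0 / 0\<close> in the estimator is 0, in accordance
  with \<open>r\<close>. This keeps the bounds below valid at every point.
\<close>

definition r :: "real \<Rightarrow> real" where "r w = (if 0 < w then \<phi> w / w else 0)"

text \<open>
  \<open>E i\<close> is the partial derivative of \<open>x\<^sub>i * r W\<close> in \<open>x\<^sub>i\<close> without its (nonnegative) term in \<open>\<phi>'\<close>, and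
  \<open>F k\<close> is that of \<open>z\<^sub>k * W * (r W)\<^sup>2 * B / A\<close> in \<open>z\<^sub>k\<close> without its (nonpositive) terms in \<open>\<phi>'\<close>.
\<close>

definition E :: "'p \<Rightarrow> (real^'p) \<times> (real^'n) \<Rightarrow> real" where
  "E i y = r (W y) * (1 - 2 * ((fst y $ i)\<^sup>2 / (c $ i * d $ i)) / A y)"
definition F :: "'n \<Rightarrow> (real^'p) \<times> (real^'n) \<Rightarrow> real" where
  "F k y = W y * r (W y) * r (W y) * (B y / A y) * (1 + 2 * (snd y $ k)\<^sup>2 / S y)"

lemma sets_eq[measurable_cong]: "sets \<mu> = sets borel" "sets \<nu> = sets borel"
  by (simp_all add: \<mu>_def \<nu>_def)

lemma fst_nth_measurable[measurable]: "(\<lambda>y::(real^'p) \<times> (real^'n). fst y $ i) \<in> borel_measurable borel"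
  and snd_nth_measurable[measurable]: "(\<lambda>y::(real^'p) \<times> (real^'n). snd y $ k) \<in> borel_measurable borel"
  and S_measurable[measurable]: "S \<in> borel_measurable borel"
  unfolding S_def by (intro borel_measurable_continuous_onI continuous_intros)+

lemma A_measurable[measurable]: "A \<in> borel_measurable borel"
  and B_measurable[measurable]: "B \<in> borel_measurable borel"
  unfolding A_def[abs_def] B_def[abs_def] by measurable

lemma W_measurable[measurable]: "W \<in> borel_measurable borel"
  unfolding W_def[abs_def] by measurable

lemma Q_measurable[measurable]: "Q \<in> borel_measurable borel"
  unfolding Q_def S_def[symmetric] by measurable

text \<open>Differentiability makes phi continuous on the open half-line only; cutting phi off
  outside that open set yields a Borel function.\<close>

lemma r_measurable[measurable]: "r \<in> borel_measurable borel"
proof -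
  have "(\<lambda>w. if w \<in> {0<..} then \<phi> w else 0) \<in> borel_measurable borel"
    by (rule borel_measurable_continuous_on_if)
      (auto intro!: continuous_at_imp_continuous_on DERIV_isCont[OF \<phi>_deriv])
  then have "(\<lambda>w. (if w \<in> {0<..} then \<phi> w else 0) / w) \<in> borel_measurable borel"
    by measurable
  moreover have "r = (\<lambda>w. (if w \<in> {0<..} then \<phi> w else 0) / w)"
    by (auto simp: r_def fun_eq_iff)
  ultimately show ?thesis by simp
qed

lemma E_measurable[measurable]: "E i \<in> borel_measurable borel"
  and F_measurable[measurable]: "F k \<in> borel_measurable borel"
  unfolding E_def[abs_def] F_def[abs_def] by measurable

lemma A_nonneg: "0 \<le> A y" and B_nonneg: "0 \<le> B y" and S_nonneg: "0 \<le> S y"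
  using c d by (auto simp: A_def B_def S_def less_imp_le intro!: sum_nonneg)

lemma W_nonneg: "0 \<le> W y"
  by (simp add: W_def A_nonneg S_nonneg)

lemmas \<phi>_mono = nondecreasing_on_positives[OF \<phi>_deriv \<phi>']

lemma r_nonneg: "0 \<le> r w" and r_le: "r w \<le> v" and v_nonneg: "0 \<le> v"
proof -
  show "0 \<le> r w" using \<phi>_nonneg by (simp add: r_def)
  show v: "0 \<le> v" using \<phi>_nonneg[of 1] \<phi>_quotient[of 1] by simp
  then show "r w \<le> v" using \<phi>_quotient by (simp add: r_def)
qed

lemma L_nonneg: "0 \<le> L"
  using \<phi>_nonneg[of 1] \<phi>_le[of 1] by simp

lemma mult_r: "0 \<le> w * r w \<and> w * r w \<le> L" if "0 \<le> w"
  using that \<phi>_nonneg \<phi>_le L_nonneg by (simp add: r_def)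

lemma mult_r_r: "w * r w * r w = \<phi> w * (\<phi> w / w)" if "0 \<le> w"
  using that by (auto simp: r_def)

lemma m_nonneg: "0 \<le> m"
  using weight_le[of undefined] c[of undefined] d[of undefined]
  by (meson divide_nonneg_pos order_trans powr_ge_zero)

text \<open>The weight is the ratio of the i-th coefficients of the quadratic forms \<open>B\<close>
  and \<open>A\<close>, so a bound on the weights is a bound on B/A.\<close>

lemma weight_split: "d $ i powr (1 - j) / c $ i * (1 / (c $ i * d $ i)) = d $ i powr (- j) / (c $ i)\<^sup>2"
  using d[of i] by (simp add: powr_diff powr_minus power2_eq_square field_simps)

lemma B_le: "B y \<le> m * A y"
  unfolding A_def B_def sum_distrib_left
proof (rule sum_mono)
  fix i
  have "d $ i powr (- j) / (c $ i)\<^sup>2 * (fst y $ i)\<^sup>2 =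
    d $ i powr (1 - j) / c $ i * ((fst y $ i)\<^sup>2 / (c $ i * d $ i))"
    unfolding weight_split[symmetric] by simp
  also have "\<dots> \<le> m * ((fst y $ i)\<^sup>2 / (c $ i * d $ i))"
    using c[of i] d[of i] by (intro mult_right_mono weight_le) auto
  finally show "d $ i powr (- j) / (c $ i)\<^sup>2 * (fst y $ i)\<^sup>2 \<le> m * ((fst y $ i)\<^sup>2 / (c $ i * d $ i))" .
qed

lemma BA: "0 \<le> B y / A y" "B y / A y \<le> m"
  using A_nonneg[of y] B_nonneg[of y] B_le[of y] m_nonneg
  by (auto simp: divide_le_eq)

lemma summand_le_A: "(fst y $ i)\<^sup>2 / (c $ i * d $ i) \<le> A y"
  unfolding A_def using c d by (intro member_le_sum) (auto simp: less_imp_le)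

lemma square_le_S: "(snd y $ k)\<^sup>2 \<le> S y"
  using member_le_sum[of k UNIV "\<lambda>k. (snd y $ k)\<^sup>2"]
  by (simp add: S_def inner_vec_def power2_eq_square)

lemma E_bounded: "\<bar>E i y\<bar> \<le> v"
proof -
  let ?q = "(fst y $ i)\<^sup>2 / (c $ i * d $ i) / A y"
  have "x / A y \<le> 1" if "x \<le> A y" for x
    using that A_nonneg[of y] by (auto simp: divide_le_eq)
  then have "?q \<le> 1" using summand_le_A by blast
  moreover have "0 \<le> ?q" using A_nonneg[of y] c[of i] d[of i] by simp
  ultimately have "\<bar>1 - 2 * ?q\<bar> \<le> 1" by linarith
  then have "\<bar>r (W y)\<bar> * \<bar>1 - 2 * ?q\<bar> \<le> v * 1"
    using r_nonneg r_le v_nonneg by (intro mult_mono) auto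
  then show ?thesis by (simp add: E_def abs_mult)
qed

text \<open>The factors W r, r, B/A and 1 + 2 z_k^2 / S are at most L, v, m and 3. Boundedness gives
  integrability over the finite measure \<nu>.\<close>

lemma F_bounded: "\<bar>F k y\<bar> \<le> L * v * m * 3"
proof -
  let ?q = "(snd y $ k)\<^sup>2 / S y"
  have q: "0 \<le> ?q" "?q \<le> 1"
    using square_le_S[of y k] S_nonneg[of y] by (auto simp: divide_le_eq)
  have "F k y = W y * r (W y) * r (W y) * (B y / A y) * (1 + 2 * ?q)" by (simp add: F_def)
  moreover have "\<dots> \<le> L * v * m * 3"
    using mult_r[OF W_nonneg[of y]] r_nonneg r_le BA q L_nonneg v_nonneg m_nonneg
    by (intro mult_mono mult_nonneg_nonneg) auto
  moreover have "0 \<le> \<dots>" using L_nonneg v_nonneg m_nonneg by simp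
  moreover have "0 \<le> W y * r (W y) * r (W y) * (B y / A y) * (1 + 2 * ?q)"
    using W_nonneg r_nonneg BA q by (intro mult_nonneg_nonneg) auto
  ultimately show ?thesis by linarith
qed

abbreviation "bx i \<equiv> (axis i 1, 0) :: (real^'p) \<times> (real^'n)"
abbreviation "bz k \<equiv> (0, axis k 1) :: (real^'p) \<times> (real^'n)"

lemma bx_Basis: "bx i \<in> Basis" and bz_Basis: "bz k \<in> Basis"
  by (auto simp: Basis_prod_def axis_in_Basis_iff)

lemma inner_bx: "y \<bullet> bx i = fst y $ i" and inner_bz: "y \<bullet> bz k = snd y $ k"
  by (cases y; simp add: inner_axis)+

lemma Q_bx: "Q (y + s *\<^sub>R bx i) = Q y + (2 * (y \<bullet> bx i - \<theta> $ i) * s + s\<^sup>2) / d $ i"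
proof -
  have "(\<Sum>l\<in>UNIV. (fst (y + s *\<^sub>R bx i) $ l - \<theta> $ l)\<^sup>2 / d $ l) =
      (\<Sum>l\<in>UNIV. (fst y $ l - \<theta> $ l)\<^sup>2 / d $ l + (if l = i then (2 * (fst y $ i - \<theta> $ i) * s + s\<^sup>2) / d $ i else 0))"
    by (intro sum.cong refl) (auto simp: axis_def power2_eq_square add_divide_distrib[symmetric] algebra_simps)
  also have "\<dots> = (\<Sum>l\<in>UNIV. (fst y $ l - \<theta> $ l)\<^sup>2 / d $ l) + (2 * (fst y $ i - \<theta> $ i) * s + s\<^sup>2) / d $ i"
    by (simp add: sum.distrib)
  finally show ?thesis by (simp add: Q_def inner_bx)
qed

lemma S_bz: "S (y + s *\<^sub>R bz k) = S y - (snd y $ k)\<^sup>2 + (snd y $ k + s)\<^sup>2"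
  by (simp add: S_def inner_add_left inner_add_right inner_axis inner_axis' power2_eq_square algebra_simps)

text \<open>The 0 and the 1 fit the shape of \<open>stein_inequality\<close>: noise coordinates are
  centred at 0 and enter Q with unit coefficient.\<close>

lemma Q_bz: "Q (y + s *\<^sub>R bz k) = Q y + (2 * (y \<bullet> bz k - 0) * s + s\<^sup>2) / 1"
  using S_bz[of y s k] by (simp add: Q_def S_def inner_bz power2_eq_square algebra_simps)

text \<open>The part of \<open>A\<close> that is constant along lines in direction i. If it is
  positive, such a line never meets \<open>A\<close> = 0; since p \<ge> 2, this holds whenever all
  coordinates are nonzero.\<close>

definition A' :: "'p \<Rightarrow> (real^'p) \<times> (real^'n) \<Rightarrow> real" where "A' i y = (\<Sum>l\<in>UNIV - {i}. (fst y $ l)\<^sup>2 / (c $ l * d $ l))"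

lemma A_bx: "A (y + s *\<^sub>R bx i) = A' i y + 1 / (c $ i * d $ i) * (fst y $ i + s)\<^sup>2"
proof -
  have "A (y + s *\<^sub>R bx i) = (fst y $ i + s)\<^sup>2 / (c $ i * d $ i) + A' i (y + s *\<^sub>R bx i)"
    unfolding A_def A'_def by (subst sum.remove[of _ i]) auto
  moreover have "A' i (y + s *\<^sub>R bx i) = A' i y"
    unfolding A'_def by (intro sum.cong) (auto simp: axis_def)
  ultimately show ?thesis by simp
qed

text \<open>From such a point, lines in a location direction avoid both \<open>A\<close> = 0 and
  \<open>S\<close> = 0, and lines in a noise direction avoid \<open>A\<close> = 0.\<close>

lemma AE_generic: "AE y in lborel. (\<forall>i. fst y $ i \<noteq> 0) \<and> (\<forall>k. snd (y :: (real^'p) \<times> (real^'n)) $ k \<noteq> 0)"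
proof -
  have "AE y in lborel. \<forall>i\<in>UNIV. y \<bullet> bx i \<noteq> 0" "AE y in lborel. \<forall>k\<in>UNIV. y \<bullet> bz k \<noteq> 0"
    by (subst AE_finite_all; simp add: AE_lborel_inner_neq bx_Basis bz_Basis)+
  then show ?thesis by (simp add: inner_bx inner_bz)
qed

lemma A'_pos: "0 < A' i y" if "\<And>l. fst y $ l \<noteq> 0"
proof -
  have "\<exists>l. l \<noteq> i"
  proof (rule ccontr)
    assume "\<nexists>l. l \<noteq> i"
    then have "(UNIV :: 'p set) = {i}" by auto
    then show False using card by (metis card_1_singleton_iff One_nat_def Suc_1 not_less_eq_eq order_refl)
  qed
  then show ?thesis unfolding A'_def using that c d by (intro sum_pos) auto
qed

lemma A_pos: "0 < A y" if "\<And>l. fst y $ l \<noteq> 0"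
  unfolding A_def using that c d by (intro sum_pos) auto

lemma S_pos: "0 < S y" if "\<And>k. snd y $ k \<noteq> 0"
proof -
  have "snd y \<noteq> 0" using that by auto
  then show ?thesis by (simp add: S_def)
qed

lemma integrable_deviation: "integrable \<mu> (\<lambda>y. (fst y $ i - t)\<^sup>2)"
proof -
  have "integrable \<mu> (\<lambda>y. 2 * (fst y $ i)\<^sup>2 + 2 * t\<^sup>2)"
    by (intro Bochner_Integration.integrable_add integrable_mult_right second_moment
        finite_measure.integrable_const[OF \<mu>_finite])
  then show ?thesis
  proof (rule Bochner_Integration.integrable_bound)
    have "(a - t)\<^sup>2 \<le> 2 * a\<^sup>2 + 2 * t\<^sup>2" for a :: real
      using zero_le_power2[of "a + t"] by (simp add: power2_eq_square algebra_simps)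
    then show "AE y in \<mu>. norm ((fst y $ i - t)\<^sup>2) \<le> norm (2 * (fst y $ i)\<^sup>2 + 2 * t\<^sup>2)"
      by (intro AE_I2) (auto intro: order_trans[OF _ abs_ge_self])
  qed measurable
qed

text \<open>The product of two deviations is at most the sum of their squares. Two centres t and s
  are allowed since the Stein inequality pairs x_i - \<theta>_i with x_i.\<close>

lemma integrable_product:
  assumes [measurable]: "h \<in> borel_measurable borel" and h: "\<And>y. \<bar>h y\<bar> \<le> v"
  shows "integrable \<mu> (\<lambda>y. (fst y $ i - t) * ((fst y $ i - s) * h y))"
proof -
  have "integrable \<mu> (\<lambda>y. v * ((fst y $ i - t)\<^sup>2 + (fst y $ i - s)\<^sup>2))"
    using integrable_deviation by auto
  then show ?thesis
  proof (rule Bochner_Integration.integrable_bound)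
    have ab: "\<bar>a * b\<bar> \<le> a\<^sup>2 + b\<^sup>2" for a b :: real
    proof -
      have "2 * (\<bar>a\<bar> * \<bar>b\<bar>) \<le> a\<^sup>2 + b\<^sup>2"
        using zero_le_power2[of "\<bar>a\<bar> - \<bar>b\<bar>"] by (simp add: power2_diff)
      moreover have "0 \<le> \<bar>a\<bar> * \<bar>b\<bar>" by simp
      ultimately show ?thesis unfolding abs_mult by linarith
    qed
    have "\<bar>(a * b) * h y\<bar> \<le> (a\<^sup>2 + b\<^sup>2) * v" for a b y
      unfolding abs_mult[of "a * b"] by (intro mult_mono ab h) auto
    then have abh: "\<bar>a * (b * h y)\<bar> \<le> v * (a\<^sup>2 + b\<^sup>2)" for a b y
      by (simp only: mult_ac)
    show "AE y in \<mu>. norm ((fst y $ i - t) * ((fst y $ i - s) * h y)) \<le>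
       norm (v * ((fst y $ i - t)\<^sup>2 + (fst y $ i - s)\<^sup>2))"
      unfolding real_norm_def by (intro AE_I2 order_trans[OF abh abs_ge_self])
  qed measurable
qed

lemma \<nu>_finite: "finite_measure \<nu>"
  unfolding \<nu>_def
  by (rule finite_measure_tail[OF g_meas Q_measurable bx_Basis g d Q_bx])
    (use integrable_deviation in \<open>simp add: inner_bx \<mu>_def\<close>)

text \<open>Stein's inequality for the component x_i r(W). Dropping the phi' term lowers the
  left-hand side, and the coefficient of this term in the risk is negative, so the direction is the
  useful one.\<close>

lemma stein_location: "d $ i * (\<integral>y. E i y \<partial>\<nu>) \<le> (\<integral>y. (fst y $ i - \<theta> $ i) * (fst y $ i * r (W y)) \<partial>\<mu>)"
proof -
  let ?u = "\<lambda>y :: (real^'p) \<times> (real^'n). fst y $ i - \<theta> $ i"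
  have seg: "(LINT s:{0..t}|lborel. E i (y + (\<kappa> * s) *\<^sub>R bx i)) \<le>
      \<kappa> * ((fst y $ i + \<kappa> * t) * r (W (y + (\<kappa> * t) *\<^sub>R bx i)) - fst y $ i * r (W y))"
    if y: "\<And>l. fst y $ l \<noteq> 0" "\<And>k. snd y $ k \<noteq> 0" and t: "0 \<le> t" and \<kappa>: "\<kappa>\<^sup>2 = 1" for y \<kappa> t
  proof -
    have S: "0 < S y" by (rule S_pos[OF y(2)])
    have SS: "S (y + s *\<^sub>R bx i) = S y" for s by (simp add: S_def)
    have pos: "0 < A' i y + 1 / (c $ i * d $ i) * x\<^sup>2" for x
      using A'_pos[OF y(1), of i] c[of i] d[of i] by (intro add_pos_nonneg) auto
    have rW: "r (W (y + s *\<^sub>R bx i)) =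
      \<phi> ((A' i y + 1 / (c $ i * d $ i) * (fst y $ i + s)\<^sup>2) / S y) / ((A' i y + 1 / (c $ i * d $ i) * (fst y $ i + s)\<^sup>2) / S y)" for s
      unfolding r_def W_def A_bx SS using pos[of "fst y $ i + s"] S by simp
    have EE: "E i (y + s *\<^sub>R bx i) = r (W (y + s *\<^sub>R bx i)) *
      (1 - 2 * (1 / (c $ i * d $ i)) * (fst y $ i + s)\<^sup>2 / (A' i y + 1 / (c $ i * d $ i) * (fst y $ i + s)\<^sup>2))" for s
      unfolding E_def A_bx by simp
    have r0: "r (W y) = \<phi> ((A' i y + 1 / (c $ i * d $ i) * (fst y $ i)\<^sup>2) / S y) / ((A' i y + 1 / (c $ i * d $ i) * (fst y $ i)\<^sup>2) / S y)"
      using rW[of 0] by (simp add: zero_prod_def[symmetric])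
    show ?thesis unfolding EE rW r0
      by (rule shrinkage_segment[OF \<phi>_deriv \<phi>' _ A'_pos[OF y(1)] S \<kappa> t]) (use c[of i] d[of i] in auto)
  qed
  define G where "G y = fst y $ i * r (W y)" for y
  have [measurable]: "G \<in> borel_measurable borel" unfolding G_def[abs_def] by measurable
  have G0: "G (y - ?u y *\<^sub>R bx i) = \<theta> $ i * r (W (y - ?u y *\<^sub>R bx i))" for y
    by (simp add: G_def)
  have [measurable]: "(\<lambda>y. r (W (y - ?u y *\<^sub>R bx i))) \<in> borel_measurable borel"
    by (rule measurable_compose[of "\<lambda>y. y - ?u y *\<^sub>R bx i" borel borel]) measurable
  have r_abs: "\<bar>r w\<bar> \<le> v" for w using r_nonneg r_le by simp
  have int1: "integrable \<mu> (\<lambda>y. ?u y * G y)"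
    using integrable_product[of "\<lambda>y. r (W y)" i "\<theta> $ i" 0] r_abs by (simp add: G_def)
  \<comment> \<open>On the hyperplane the factor x_i has become \<theta>_i, which is written as x_i
    - (x_i - \<theta>_i) to reach the form of \<open>integrable_product\<close>.\<close>
  have int2: "integrable \<mu> (\<lambda>y. ?u y * G (y - ?u y *\<^sub>R bx i))"
  proof -
    have "integrable \<mu> (\<lambda>y. ?u y * (fst y $ i * r (W (y - ?u y *\<^sub>R bx i))) - ?u y * (?u y * r (W (y - ?u y *\<^sub>R bx i))))"
      using integrable_product[of "\<lambda>y. r (W (y - ?u y *\<^sub>R bx i))" i "\<theta> $ i" 0]
        integrable_product[of "\<lambda>y. r (W (y - ?u y *\<^sub>R bx i))" i "\<theta> $ i" "\<theta> $ i"] r_abs by simp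
    then show ?thesis unfolding G0 by (simp add: algebra_simps)
  qed
  have "d $ i * (\<integral>y. E i y \<partial>\<nu>) \<le> (\<integral>y. (y \<bullet> bx i - \<theta> $ i) * G y \<partial>\<mu>)"
    unfolding \<mu>_def \<nu>_def
  proof (rule stein_inequality[where K=v])
    show "AE x in lborel. 0 < x \<bullet> bx i - \<theta> $ i \<longrightarrow>
            (LINT s:{0..x \<bullet> bx i - \<theta> $ i}|lborel. E i (x - s *\<^sub>R bx i)) \<le> G x - G (x - (x \<bullet> bx i - \<theta> $ i) *\<^sub>R bx i)"
      using AE_generic
    proof (rule eventually_mono, intro impI)
      fix y :: "(real^'p) \<times> (real^'n)"
      assume y: "(\<forall>i. fst y $ i \<noteq> 0) \<and> (\<forall>k. snd y $ k \<noteq> 0)" and pos: "0 < y \<bullet> bx i - \<theta> $ i"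
      have "y + (- 1 * s) *\<^sub>R bx i = y - s *\<^sub>R bx i" for s
        by (simp only: mult_minus1 scaleR_minus_left diff_conv_add_uminus)
      from seg[of y "y \<bullet> bx i - \<theta> $ i" "- 1", unfolded this]
      show "(LINT s:{0..y \<bullet> bx i - \<theta> $ i}|lborel. E i (y - s *\<^sub>R bx i)) \<le> G y - G (y - (y \<bullet> bx i - \<theta> $ i) *\<^sub>R bx i)"
        using y pos by (simp add: inner_bx G_def)
    qed
    show "AE x in lborel. x \<bullet> bx i - \<theta> $ i < 0 \<longrightarrow>
            (LINT s:{0..- (x \<bullet> bx i - \<theta> $ i)}|lborel. E i (x + s *\<^sub>R bx i)) \<le> G (x - (x \<bullet> bx i - \<theta> $ i) *\<^sub>R bx i) - G x"
      using AE_generic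
    proof (rule eventually_mono, intro impI)
      fix y :: "(real^'p) \<times> (real^'n)"
      assume y: "(\<forall>i. fst y $ i \<noteq> 0) \<and> (\<forall>k. snd y $ k \<noteq> 0)" and neg: "y \<bullet> bx i - \<theta> $ i < 0"
      have "y + (1 * - (y \<bullet> bx i - \<theta> $ i)) *\<^sub>R bx i = y - (y \<bullet> bx i - \<theta> $ i) *\<^sub>R bx i"
        by (simp only: mult_1_left scaleR_minus_left diff_conv_add_uminus)
      from seg[of y "- (y \<bullet> bx i - \<theta> $ i)" 1, unfolded this]
      show "(LINT s:{0..- (y \<bullet> bx i - \<theta> $ i)}|lborel. E i (y + s *\<^sub>R bx i)) \<le> G (y - (y \<bullet> bx i - \<theta> $ i) *\<^sub>R bx i) - G y"
        using y neg by (simp add: inner_bx G_def)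
    qed
  qed (use g d bx_Basis Q_bx E_bounded \<nu>_finite int1 int2 in \<open>simp_all add: inner_bx \<mu>_def \<nu>_def\<close>)
  then show ?thesis by (simp add: inner_bx G_def)
qed

lemma integrable_B: "integrable \<mu> B"
  unfolding B_def[abs_def] by (intro Bochner_Integration.integrable_sum integrable_mult_right second_moment)

text \<open>Chosen so that S * V is r^2 B off the zero sets of \<open>A\<close> and
  \<open>S\<close>. This spreads the quadratic term of the loss difference over the noise directions
  as a sum of z_k^2 V.\<close>

definition V :: "(real^'p) \<times> (real^'n) \<Rightarrow> real" where "V y = W y * r (W y) * r (W y) * (B y / A y)"

lemma V_measurable[measurable]: "V \<in> borel_measurable borel"
  unfolding V_def[abs_def] by measurable

lemma V_nonneg: "0 \<le> V y"
  unfolding V_def using W_nonneg r_nonneg BA by (intro mult_nonneg_nonneg) auto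

lemma S_V_le: "S y * V y \<le> v\<^sup>2 * B y"
proof -
  have "S y * V y = (S y * W y) * (B y / A y) * (r (W y) * r (W y))" by (simp add: V_def)
  also have "\<dots> \<le> B y * (v * v)"
  proof (intro mult_mono)
    \<comment> \<open>Where \<open>S\<close> or \<open>A\<close> vanishes the left side is 0 by the
      division convention, so no exceptional points remain.\<close>
    show "S y * W y * (B y / A y) \<le> B y"
      using B_nonneg[of y] by (auto simp: W_def)
  qed (use r_nonneg r_le v_nonneg B_nonneg in auto)
  finally show ?thesis by (simp add: power2_eq_square mult.commute)
qed

lemma integrable_V: "integrable \<mu> (\<lambda>y. (snd y $ k)\<^sup>2 * V y)"
proof (rule Bochner_Integration.integrable_bound)
  show "integrable \<mu> (\<lambda>y. v\<^sup>2 * B y)" by (intro integrable_mult_right integrable_B)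
  show "AE y in \<mu>. norm ((snd y $ k)\<^sup>2 * V y) \<le> norm (v\<^sup>2 * B y)"
  proof (intro AE_I2)
    fix y
    have "(snd y $ k)\<^sup>2 * V y \<le> S y * V y" by (intro mult_right_mono square_le_S V_nonneg)
    also have "\<dots> \<le> v\<^sup>2 * B y" by (rule S_V_le)
    finally show "norm ((snd y $ k)\<^sup>2 * V y) \<le> norm (v\<^sup>2 * B y)"
      using V_nonneg[of y] B_nonneg[of y] by simp
  qed
qed measurable

text \<open>An upper bound is wanted, so \<open>stein_inequality\<close> is applied to -F and -z_k
  V. The latter vanishes on z_k = 0, hence no boundary value has to be handled.\<close>

lemma stein_noise: "(\<integral>y. (snd y $ k)\<^sup>2 * V y \<partial>\<mu>) \<le> (\<integral>y. F k y \<partial>\<nu>)"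
proof -
  define G where "G y = - (snd y $ k * V y)" for y
  have [measurable]: "G \<in> borel_measurable borel" unfolding G_def[abs_def] by measurable
  have seg: "(LINT s:{0..t}|lborel. - F k (y - (s * \<kappa>) *\<^sub>R bz k)) \<le> - (t * V y)"
    if y: "\<And>l. fst y $ l \<noteq> 0" and t: "t = \<kappa> * snd y $ k" "0 < t" and \<kappa>: "\<kappa>\<^sup>2 = 1" for y \<kappa> t
  proof -
    \<comment> \<open>The squared length of the remaining noise coordinates, which is 0 for n = 1.
      In this proof \<kappa> is the sign of z_k and t its absolute value.\<close>
    define \<sigma> where "\<sigma> = S y - (snd y $ k)\<^sup>2"
    have \<sigma>: "0 \<le> \<sigma>" using square_le_S[of y k] by (simp add: \<sigma>_def)
    have A: "0 < A y" by (rule A_pos[OF y])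
    have z: "snd y $ k = \<kappa> * t" using \<kappa> t by (simp add: power2_eq_square mult.assoc[symmetric])
    have sq: "(snd y $ k - s * \<kappa>)\<^sup>2 = (t - s)\<^sup>2" for s
    proof -
      have "snd y $ k - s * \<kappa> = \<kappa> * (t - s)" by (simp add: z algebra_simps)
      then show ?thesis using \<kappa> by (simp add: power_mult_distrib)
    qed
    have SS: "S (y - (s * \<kappa>) *\<^sub>R bz k) = \<sigma> + (t - s)\<^sup>2" for s
    proof -
      have eq: "y - (s * \<kappa>) *\<^sub>R bz k = y + (- (s * \<kappa>)) *\<^sub>R bz k"
        by (simp only: scaleR_minus_left diff_conv_add_uminus)
      show ?thesis unfolding eq S_bz \<sigma>_def by (simp add: sq)
    qed
    have AA: "A (y - (s * \<kappa>) *\<^sub>R bz k) = A y" "B (y - (s * \<kappa>) *\<^sub>R bz k) = B y" for s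
      by (simp_all add: A_def B_def)
    have F_eq: "F k (y - (s * \<kappa>) *\<^sub>R bz k) = \<phi> (A y / (\<sigma> + (t - s)\<^sup>2)) * (\<phi> (A y / (\<sigma> + (t - s)\<^sup>2)) / (A y / (\<sigma> + (t - s)\<^sup>2))) * (B y / A y) *
          (1 + 2 * (t - s)\<^sup>2 / (\<sigma> + (t - s)\<^sup>2))" for s
    proof -
      have "0 \<le> A y / (\<sigma> + (t - s)\<^sup>2)" using A \<sigma> by simp
      from mult_r_r[OF this] show ?thesis
        unfolding F_def W_def SS AA by (simp add: sq)
    qed
    have [measurable]: "(\<lambda>s. F k (y - (s * \<kappa>) *\<^sub>R bz k)) \<in> borel_measurable borel"
      by (rule measurable_compose[of _ _ borel]) measurable
    have int: "set_integrable lborel {0..t} (\<lambda>s. F k (y - (s * \<kappa>) *\<^sub>R bz k))"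
      by (rule bounded_set_integrable[where K="L * v * m * 3"]) (auto simp: F_bounded)
    have Sy: "\<sigma> + t\<^sup>2 = S y" using SS[of 0] by (simp add: zero_prod_def[symmetric])
    have V_eq: "\<phi> (A y / (\<sigma> + t\<^sup>2)) * (\<phi> (A y / (\<sigma> + t\<^sup>2)) / (A y / (\<sigma> + t\<^sup>2))) * (B y / A y) = V y"
      unfolding V_def Sy using mult_r_r[OF W_nonneg[of y]] by (simp add: W_def)
    have "t * V y \<le> (LINT s:{0..t}|lborel. F k (y - (s * \<kappa>) *\<^sub>R bz k))"
      unfolding F_eq V_eq[symmetric]
      by (rule noise_segment[OF \<phi>_mono \<phi>_nonneg A BA(1) \<sigma> t(2) int[unfolded F_eq]])
    then show ?thesis by (simp add: set_lebesgue_integral_def)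
  qed
  have "1 * (\<integral>y. - F k y \<partial>\<nu>) \<le> (\<integral>y. (y \<bullet> bz k - 0) * G y \<partial>\<mu>)"
    unfolding \<mu>_def \<nu>_def
  proof (rule stein_inequality[where K="L * v * m * 3"])
    have G0: "G (y - (y \<bullet> bz k - 0) *\<^sub>R bz k) = 0" for y by (simp add: G_def inner_bz)
    show "AE x in lborel. 0 < x \<bullet> bz k - 0 \<longrightarrow>
            (LINT s:{0..x \<bullet> bz k - 0}|lborel. - F k (x - s *\<^sub>R bz k)) \<le> G x - G (x - (x \<bullet> bz k - 0) *\<^sub>R bz k)"
      using AE_generic unfolding G0
    proof (rule eventually_mono, intro impI)
      fix y :: "(real^'p) \<times> (real^'n)"
      assume y: "(\<forall>i. fst y $ i \<noteq> 0) \<and> (\<forall>k. snd y $ k \<noteq> 0)" and pos: "0 < y \<bullet> bz k - 0"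
      then show "(LINT s:{0..y \<bullet> bz k - 0}|lborel. - F k (y - s *\<^sub>R bz k)) \<le> G y - 0"
        using seg[of y "y \<bullet> bz k" 1] by (simp add: inner_bz G_def)
    qed
    show "AE x in lborel. x \<bullet> bz k - 0 < 0 \<longrightarrow>
            (LINT s:{0..- (x \<bullet> bz k - 0)}|lborel. - F k (x + s *\<^sub>R bz k)) \<le> G (x - (x \<bullet> bz k - 0) *\<^sub>R bz k) - G x"
      using AE_generic unfolding G0
    proof (rule eventually_mono, intro impI)
      fix y :: "(real^'p) \<times> (real^'n)"
      assume y: "(\<forall>i. fst y $ i \<noteq> 0) \<and> (\<forall>k. snd y $ k \<noteq> 0)" and neg: "y \<bullet> bz k - 0 < 0"
      have "y - (s * - 1) *\<^sub>R bz k = y + s *\<^sub>R bz k" for s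
        by (simp only: mult_minus_right mult_1_right scaleR_minus_left diff_minus_eq_add)
      from seg[of y "- (y \<bullet> bz k)" "- 1", unfolded this]
      show "(LINT s:{0..- (y \<bullet> bz k - 0)}|lborel. - F k (y + s *\<^sub>R bz k)) \<le> 0 - G y"
        using y neg by (simp add: inner_bz G_def)
    qed
    show "integrable (density lborel (\<lambda>x. ennreal (g (Q x)))) (\<lambda>x. (x \<bullet> bz k - 0) * G x)"
      using integrable_V[of k] by (simp add: inner_bz G_def \<mu>_def power2_eq_square mult.assoc)
    show "integrable (density lborel (\<lambda>x. ennreal (g (Q x)))) (\<lambda>x. (x \<bullet> bz k - 0) * G (x - (x \<bullet> bz k - 0) *\<^sub>R bz k))"
      unfolding G0 by simp
    show "Q (y + s *\<^sub>R bz k) = Q y + (2 * (y \<bullet> bz k - 0) * s + s\<^sup>2) / 1" for y s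
      by (rule Q_bz)
    show "finite_measure (density lborel (\<lambda>x. tail g (Q x)))"
      using \<nu>_finite by (simp add: \<nu>_def)
  qed (use g bz_Basis F_bounded in simp_all)
  then show ?thesis by (simp add: inner_bz G_def power2_eq_square mult.assoc)
qed

lemma bounded_integrable_\<nu>: "integrable \<nu> h" if [measurable]: "h \<in> borel_measurable borel" and "\<And>y. \<bar>h y\<bar> \<le> K" for h :: "(real^'p) \<times> (real^'n) \<Rightarrow> real"
  by (rule finite_measure.integrable_const_bound[OF \<nu>_finite, where B=K]) (use that in auto)

text \<open>The loss of the shrinkage estimator minus that of X, before division by the
  scale.\<close>

definition loss_change :: "(real^'p) \<times> (real^'n) \<Rightarrow> real" where
  "loss_change y = (\<Sum>i\<in>UNIV. d $ i powr (- j) *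
     ((((1 - r (W y) / c $ i) * fst y $ i) - \<theta> $ i)\<^sup>2 - (fst y $ i - \<theta> $ i)\<^sup>2))"

lemma loss_change_eq: "loss_change y = (\<Sum>i\<in>UNIV. - 2 * (d $ i powr (- j) / c $ i) * ((fst y $ i - \<theta> $ i) * (fst y $ i * r (W y)))) + (r (W y))\<^sup>2 * B y"
proof -
  have eq: "d $ i powr (- j) * ((((1 - r (W y) / c $ i) * fst y $ i) - \<theta> $ i)\<^sup>2 - (fst y $ i - \<theta> $ i)\<^sup>2) =
     - 2 * (d $ i powr (- j) / c $ i) * ((fst y $ i - \<theta> $ i) * (fst y $ i * r (W y))) +
     (r (W y))\<^sup>2 * (d $ i powr (- j) / (c $ i)\<^sup>2 * (fst y $ i)\<^sup>2)" for i
    by (simp add: power2_eq_square algebra_simps)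
  show ?thesis unfolding loss_change_def B_def eq by (simp only: sum.distrib sum_distrib_left)
qed

lemma sum_V: "(\<Sum>k\<in>UNIV. (snd y $ k)\<^sup>2 * V y) = (r (W y))\<^sup>2 * B y" if "0 < A y" "0 < S y"
proof -
  have "(\<Sum>k\<in>UNIV. (snd y $ k)\<^sup>2 * V y) = S y * V y"
    by (simp add: S_def inner_vec_def power2_eq_square sum_distrib_right)
  also have "\<dots> = (r (W y))\<^sup>2 * B y"
    using that by (simp add: V_def W_def power2_eq_square)
  finally show ?thesis .
qed

text \<open>After division by r the sum is -2 \<Sum> w_i + 4 b + (n+2) W r b with b = B/A. The 4 b
  is the weighted sum of the correction terms in \<open>E\<close>, and n+2 arises since the z_k^2
  add up to S. The bounds b \<le> m and W r \<le> L reduce the claim to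
  \<open>weight_sum\<close>.\<close>

lemma unbiased_estimate_nonpos:
  assumes "0 < A y" "0 < S y"
  shows "(\<Sum>i\<in>UNIV. - 2 * (d $ i powr (- j) / c $ i) * (d $ i * E i y)) + (\<Sum>k\<in>UNIV. F k y) \<le> 0"
proof -
  define R where "R = r (W y)"
  define b where "b = B y / A y"
  define w where "w i = d $ i powr (1 - j) / c $ i" for i
  have w: "d $ i powr (- j) / c $ i * d $ i = w i" for i
    using d[of i] by (simp add: w_def powr_diff powr_minus field_simps)
  have wa: "w i * ((fst y $ i)\<^sup>2 / (c $ i * d $ i)) = d $ i powr (- j) / (c $ i)\<^sup>2 * (fst y $ i)\<^sup>2" for i
    unfolding weight_split[of i, symmetric] w_def by simp
  have E: "- 2 * (d $ i powr (- j) / c $ i) * (d $ i * E i y) =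
      - 2 * R * w i + 4 * R / A y * (w i * ((fst y $ i)\<^sup>2 / (c $ i * d $ i)))" for i
    unfolding w[symmetric] E_def R_def by (simp add: algebra_simps)
  have "(\<Sum>i\<in>UNIV. - 2 * (d $ i powr (- j) / c $ i) * (d $ i * E i y)) =
      - 2 * R * (\<Sum>i\<in>UNIV. w i) + 4 * R / A y * B y"
    unfolding E wa by (simp only: sum.distrib sum_distrib_left B_def)
  also have "\<dots> = R * (4 * b - 2 * (\<Sum>i\<in>UNIV. w i))"
    by (simp add: b_def algebra_simps)
  finally have 1: "(\<Sum>i\<in>UNIV. - 2 * (d $ i powr (- j) / c $ i) * (d $ i * E i y)) = R * (4 * b - 2 * (\<Sum>i\<in>UNIV. w i))" .
  have "(\<Sum>k\<in>UNIV. 1 + 2 * (snd y $ k)\<^sup>2 / S y) = real CARD('n) + 2 * (\<Sum>k\<in>UNIV. (snd y $ k)\<^sup>2) / S y"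
    by (simp add: sum.distrib sum_distrib_left sum_divide_distrib)
  also have "(\<Sum>k\<in>UNIV. (snd y $ k)\<^sup>2) = S y"
    by (simp add: S_def inner_vec_def power2_eq_square)
  finally have "(\<Sum>k\<in>UNIV. 1 + 2 * (snd y $ k)\<^sup>2 / S y) = real CARD('n) + 2"
    using assms by simp
  then have 2: "(\<Sum>k\<in>UNIV. F k y) = R * (W y * R * b * (real CARD('n) + 2))"
    unfolding F_def sum_distrib_left[symmetric] by (simp add: R_def b_def)
  have "W y * R * b * (real CARD('n) + 2) \<le> L * m * (real CARD('n) + 2)"
    using mult_r[OF W_nonneg[of y]] BA[of y] L_nonneg m_nonneg unfolding R_def b_def
    by (intro mult_mono) auto
  moreover have "4 * b \<le> 4 * m" using BA[of y] by (simp add: b_def)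
  ultimately have "4 * b - 2 * (\<Sum>i\<in>UNIV. w i) + W y * R * b * (real CARD('n) + 2) \<le> 0"
    using weight_sum by (simp add: w_def algebra_simps)
  then have "R * (4 * b - 2 * (\<Sum>i\<in>UNIV. w i) + W y * R * b * (real CARD('n) + 2)) \<le> 0"
    using r_nonneg[of "W y"] by (simp add: R_def mult_nonneg_nonpos)
  then show ?thesis unfolding 1 2 by (simp add: distrib_left)
qed

lemma integrable_xr: "integrable \<mu> (\<lambda>y. (fst y $ i - \<theta> $ i) * (fst y $ i * r (W y)))"
  using integrable_product[of "\<lambda>y. r (W y)" i "\<theta> $ i" 0] r_nonneg r_le by simp

lemma AE_pos: "AE y in \<mu>. 0 < A y \<and> 0 < S y" "AE y in \<nu>. 0 < A y \<and> 0 < S y"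
proof -
  have base: "AE y in lborel. 0 < A y \<and> 0 < S y"
    using AE_generic by (rule eventually_mono) (auto intro: A_pos S_pos)
  have "AE y in density lborel h. 0 < A y \<and> 0 < S y" if [measurable]: "h \<in> borel_measurable borel" for h
    by (subst AE_density) (measurable, rule eventually_mono[OF base], simp)
  then show "AE y in \<mu>. 0 < A y \<and> 0 < S y" "AE y in \<nu>. 0 < A y \<and> 0 < S y"
    unfolding \<mu>_def \<nu>_def by simp_all
qed

lemma loss_change_integrable: "integrable \<mu> loss_change"
  and loss_change_integral: "(\<integral>y. loss_change y \<partial>\<mu>) \<le> 0"
proof -
  let ?k = "\<lambda>i. - 2 * (d $ i powr (- j) / c $ i)"
  define H where "H y = (\<Sum>i\<in>UNIV. ?k i * ((fst y $ i - \<theta> $ i) * (fst y $ i * r (W y)))) + (\<Sum>k\<in>UNIV. (snd y $ k)\<^sup>2 * V y)" for y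
  have eq: "AE y in \<mu>. H y = loss_change y"
    using AE_pos(1) by (rule eventually_mono) (simp add: H_def loss_change_eq sum_V)
  have [measurable]: "loss_change \<in> borel_measurable borel"
    unfolding loss_change_eq[abs_def] by measurable
  have H: "integrable \<mu> H" unfolding H_def
    by (intro Bochner_Integration.integrable_add Bochner_Integration.integrable_sum integrable_mult_right integrable_xr integrable_V)
  show "integrable \<mu> loss_change"
    by (rule integrable_cong_AE_imp[OF H]) (use eq in \<open>auto elim!: eventually_mono\<close>)
  have "(\<integral>y. loss_change y \<partial>\<mu>) = (\<integral>y. H y \<partial>\<mu>)"
    using eq H by (intro integral_cong_AE) (auto elim!: eventually_mono simp: borel_measurable_integrable)
  also have "\<dots> = (\<Sum>i\<in>UNIV. ?k i * (\<integral>y. (fst y $ i - \<theta> $ i) * (fst y $ i * r (W y)) \<partial>\<mu>)) + (\<Sum>k\<in>UNIV. \<integral>y. (snd y $ k)\<^sup>2 * V y \<partial>\<mu>)"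
    unfolding H_def
    by (subst Bochner_Integration.integral_add, intro Bochner_Integration.integrable_sum integrable_mult_right integrable_xr,
        intro Bochner_Integration.integrable_sum integrable_V)
      (simp add: Bochner_Integration.integral_sum integrable_xr integrable_V)
  \<comment> \<open>The coefficients \<open>?k i\<close> are nonpositive, so the lower bounds from
    \<open>stein_location\<close> turn into upper bounds here.\<close>
  also have "\<dots> \<le> (\<Sum>i\<in>UNIV. ?k i * (d $ i * (\<integral>y. E i y \<partial>\<nu>))) + (\<Sum>k\<in>UNIV. \<integral>y. F k y \<partial>\<nu>)"
    using c d by (intro add_mono sum_mono mult_left_mono_neg stein_location stein_noise) (simp add: less_imp_le)
  also have "\<dots> = (\<integral>y. (\<Sum>i\<in>UNIV. ?k i * (d $ i * E i y)) + (\<Sum>k\<in>UNIV. F k y) \<partial>\<nu>)"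
  proof -
    have E: "integrable \<nu> (E i)" for i by (rule bounded_integrable_\<nu>[OF _ E_bounded]) measurable
    have F: "integrable \<nu> (F k)" for k by (rule bounded_integrable_\<nu>[OF _ F_bounded]) measurable
    show ?thesis
      by (subst Bochner_Integration.integral_add, intro Bochner_Integration.integrable_sum integrable_mult_right E,
        intro Bochner_Integration.integrable_sum F)
       (simp add: Bochner_Integration.integral_sum E F)
  qed
  also have "\<dots> \<le> 0"
  proof -
    have "AE y in \<nu>. 0 \<le> - ((\<Sum>i\<in>UNIV. ?k i * (d $ i * E i y)) + (\<Sum>k\<in>UNIV. F k y))"
      using AE_pos(2) by (rule eventually_mono) (use unbiased_estimate_nonpos in fastforce)
    from integral_nonneg_AE[OF this] show ?thesis
      by (simp only: Bochner_Integration.integral_minus neg_0_le_iff_le)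
  qed
  finally show "(\<integral>y. loss_change y \<partial>\<mu>) \<le> 0" .
qed

lemma W_stat_W: "W_stat d c (fst y) (snd y) = W y"
  using W_stat_eq[OF d c, of "fst y" "snd y"] by (simp add: W_def A_def S_def)

lemma theta_hat_r: "theta_hat d c \<phi> y $ i = (1 - r (W y) / c $ i) * fst y $ i"
proof -
  have "\<phi> (W y) / W y = r (W y)" using W_nonneg[of y] by (auto simp: r_def)
  then show ?thesis
    using theta_hat_eq[OF c, of d \<phi> "fst y" "snd y" i] W_stat_W[of y] by simp
qed

lemma theta_hat_measurable:
  "(theta_hat d c \<phi> :: (real^'p) \<times> (real^'n) \<Rightarrow> real^'p) \<in> borel_measurable borel"
proof (subst borel_measurable_euclidean_space, intro ballI)
  fix b :: "real^'p" assume "b \<in> Basis"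
  then obtain i where b: "b = axis i 1" by (auto simp: Basis_vec_def)
  show "(\<lambda>y. theta_hat d c \<phi> (y :: (real^'p) \<times> (real^'n)) \<bullet> b) \<in> borel_measurable borel"
    by (simp add: b inner_axis theta_hat_r)
qed

text \<open>Second moments make both losses integrable, so the extended risks are real integrals and
  their difference may be formed.\<close>

lemma quadratic_risk_le:
  assumes s: "0 < s"
  shows "(\<integral>\<^sup>+ y. ennreal (loss d j (theta_hat d c \<phi> y) \<theta> s) \<partial>\<mu>) \<le>
    (\<integral>\<^sup>+ y. ennreal (loss d j (fst y) \<theta> s) \<partial>\<mu>)"
proof -
  define l where "l y = (\<Sum>i\<in>UNIV. d $ i powr (- j) * (fst y $ i - \<theta> $ i)\<^sup>2)" for y :: "(real^'p) \<times> (real^'n)"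
  have l: "integrable \<mu> l" unfolding l_def[abs_def]
    by (intro Bochner_Integration.integrable_sum integrable_mult_right integrable_deviation)
  have l_nonneg: "0 \<le> l y" for y unfolding l_def by (intro sum_nonneg) auto
  have hat: "l y + loss_change y = (\<Sum>i\<in>UNIV. d $ i powr (- j) * (theta_hat d c \<phi> y $ i - \<theta> $ i)\<^sup>2)" for y
    unfolding l_def loss_change_def theta_hat_r sum.distrib[symmetric] by (simp add: right_diff_distrib)
  have hat_nonneg: "0 \<le> l y + loss_change y" for y unfolding hat by (intro sum_nonneg) auto
  have "(\<integral>\<^sup>+ y. ennreal (loss d j (theta_hat d c \<phi> y) \<theta> s) \<partial>\<mu>) = ennreal (\<integral>y. (l y + loss_change y) / s \<partial>\<mu>)"
    unfolding loss_eq hat[symmetric] using l loss_change_integrable hat_nonneg s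
    by (intro nn_integral_eq_integral) auto
  also have "\<dots> \<le> ennreal (\<integral>y. l y / s \<partial>\<mu>)"
    using l loss_change_integrable loss_change_integral s
    by (intro ennreal_leI) (simp add: divide_right_mono)
  also have "\<dots> = (\<integral>\<^sup>+ y. ennreal (loss d j (fst y) \<theta> s) \<partial>\<mu>)"
    unfolding loss_eq l_def[symmetric] using l l_nonneg s
    by (intro nn_integral_eq_integral[symmetric]) auto
  finally show ?thesis .
qed

end

section \<open>From one fixed parameter to the statistical model\<close>

lemma sample_density_location:
  fixes d :: "real^'p"
  assumes "\<And>i. 0 < d $ i"
  shows "sample_density d f \<theta> \<sigma> y = sample_density d f 0 \<sigma> (fst y - \<theta>, snd y :: real^'n)"
  using sample_density_eq[OF assms, of f \<theta> \<sigma> "fst y" "snd y"]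
    sample_density_eq[OF assms, of f 0 \<sigma> "fst y - \<theta>" "snd y"] by simp

lemma risk_eq:
  assumes [measurable]: "(sample_density d f \<theta> \<sigma> :: (real^'p) \<times> (real^'n) \<Rightarrow> real) \<in> borel_measurable borel"
    "\<delta> \<in> borel_measurable borel"
  shows "risk d f j (\<delta> :: (real^'p) \<times> (real^'n) \<Rightarrow> real^'p) \<theta> \<sigma> =
    (\<integral>\<^sup>+ y. ennreal (loss d j (\<delta> y) \<theta> (\<sigma>\<^sup>2)) * ennreal (sample_density d f \<theta> \<sigma> y) \<partial>lborel)"
proof -
  have [measurable]: "(\<lambda>x :: real^'p. x $ i) \<in> borel_measurable borel" for i
    by (intro borel_measurable_continuous_onI continuous_intros)
  have [measurable]: "(\<lambda>y. loss d j (\<delta> y) \<theta> (\<sigma>\<^sup>2)) \<in> borel_measurable borel"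
    unfolding loss_eq by measurable
  show ?thesis unfolding risk_def sample_dist_def
    by (subst nn_integral_density) (auto simp: mult.commute)
qed

text \<open>At a fixed scale the model is a location family with density even in the error and loss
  quadratic in \<delta> - \<theta>, so \<open>location_risk_lower_bound\<close> applies with the
  maximal risk of \<delta> as \<open>R\<close>. Translation identifies the risk of X at every
  \<theta> with that at 0.\<close>

lemma risk_fst_le_max_risk:
  fixes d \<theta> :: "real^'p" and \<delta> :: "(real^'p) \<times> (real^'n) \<Rightarrow> real^'p"
  assumes d: "\<And>i. 0 < d $ i" and \<sigma>: "0 < \<sigma>"
    and dens: "\<And>\<theta>. (sample_density d f \<theta> \<sigma> :: (real^'p) \<times> (real^'n) \<Rightarrow> real) \<in> borel_measurable borel"
    and \<delta>: "\<delta> \<in> borel_measurable borel"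
  shows "risk d f j (fst :: (real^'p) \<times> (real^'n) \<Rightarrow> real^'p) \<theta> \<sigma> \<le> max_risk d f j \<delta>"
proof -
  define k where "k y = ennreal (sample_density d f 0 \<sigma> y)" for y :: "(real^'p) \<times> (real^'n)"
  define q where "q e = loss d j e 0 (\<sigma>\<^sup>2)" for e :: "real^'p"
  have q_eq: "q e = (\<Sum>i\<in>UNIV. d $ i powr (- j) * (e $ i)\<^sup>2) / \<sigma>\<^sup>2" for e
    by (simp add: q_def loss_eq)
  have [measurable]: "(\<lambda>x :: real^'p. x $ i) \<in> borel_measurable borel" for i
    by (intro borel_measurable_continuous_onI continuous_intros)
  have q_meas[measurable]: "q \<in> borel_measurable borel" unfolding q_eq[abs_def] by measurable
  have k_meas[measurable]: "k \<in> borel_measurable borel" unfolding k_def[abs_def] using dens[of 0] by measurable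
  have fst_meas[measurable]: "(fst :: (real^'p) \<times> (real^'n) \<Rightarrow> real^'p) \<in> borel_measurable borel"
    by (intro borel_measurable_continuous_onI continuous_intros)
  have loss_q: "loss d j a \<theta> (\<sigma>\<^sup>2) = q (a - \<theta>)" for a \<theta>
    by (simp add: q_eq loss_eq)
  have dens_k: "ennreal (sample_density d f \<theta> \<sigma> y) = k (fst y - \<theta>, snd y)" for y \<theta>
    unfolding k_def sample_density_location[OF d, of f \<theta> \<sigma> y] ..
  have risk: "risk d f j \<delta>' \<theta> \<sigma> = (\<integral>\<^sup>+ y. ennreal (q (\<delta>' y - \<theta>)) * k (fst y - \<theta>, snd y) \<partial>lborel)"
    if "\<delta>' \<in> borel_measurable borel" for \<delta>' :: "(real^'p) \<times> (real^'n) \<Rightarrow> real^'p" and \<theta>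
    unfolding risk_eq[OF dens that] loss_q dens_k ..
  have "risk d f j (fst :: (real^'p) \<times> (real^'n) \<Rightarrow> real^'p) \<theta> \<sigma> =
      (\<integral>\<^sup>+ y. (\<lambda>y. ennreal (q (fst y)) * k y) (y + (- \<theta>, 0)) \<partial>lborel)"
    unfolding risk[OF fst_meas] by (intro nn_integral_cong) (simp add: plus_prod_def)
  also have "\<dots> = (\<integral>\<^sup>+ y. ennreal (q (fst y)) * k y \<partial>lborel)"
    by (rule nn_integral_lborel_translate) measurable
  also have "\<dots> \<le> max_risk d f j \<delta>"
  proof (rule location_risk_lower_bound[OF k_meas _ q_meas _ _ \<delta>])
    show "k (- e, z) = k (e, z)" for e z
      unfolding k_def using sample_density_eq[OF d, of f 0 \<sigma> "- e" z] sample_density_eq[OF d, of f 0 \<sigma> e z] by simp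
    show "0 \<le> q e" for e unfolding q_eq by (intro divide_nonneg_nonneg sum_nonneg) auto
    show "q (a + e) + q (a - e) = 2 * q a + 2 * q e" for a e
    proof -
      have "(\<Sum>i\<in>UNIV. w i * ((a + e) $ i)\<^sup>2) + (\<Sum>i\<in>UNIV. w i * ((a - e) $ i)\<^sup>2) =
        2 * (\<Sum>i\<in>UNIV. w i * (a $ i)\<^sup>2) + 2 * (\<Sum>i\<in>UNIV. w i * (e $ i)\<^sup>2)" for w :: "'p \<Rightarrow> real"
        unfolding sum_distrib_left sum.distrib[symmetric]
        by (intro sum.cong refl) (simp add: power2_eq_square algebra_simps)
      then show ?thesis unfolding q_eq by (simp add: add_divide_distrib[symmetric])
    qed
    show "(\<integral>\<^sup>+ y. ennreal (q (\<delta> y - \<theta>)) * k (fst y - \<theta>, snd y) \<partial>lborel) \<le> max_risk d f j \<delta>" for \<theta>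
      unfolding risk[OF \<delta>, symmetric] max_risk_def
      by (rule SUP_upper2[of "(\<theta>, \<sigma>)"]) (use \<sigma> in auto)
  qed
  finally show ?thesis .
qed

text \<open>Measurability is assumed of the density and has to be passed on to its radial profile:
  along the curve (\<theta>, sqrt t e), with e a unit vector of the noise space, the quadratic form
  equals t.\<close>

lemma measurable_generator:
  fixes d \<theta> :: "real^'p"
  assumes d: "\<And>i. 0 < d $ i" and \<sigma>: "0 < \<sigma>"
    and [measurable]: "(sample_density d f \<theta> \<sigma> :: (real^'p) \<times> (real^'n) \<Rightarrow> real) \<in> borel_measurable borel"
  shows "(\<lambda>t. if 0 \<le> t then (\<Prod>i\<in>UNIV. d $ i powr (- 1 / 2)) * \<sigma> powi (- int CARD('p) - int CARD('n)) * f (t / \<sigma>\<^sup>2) else 0)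
    \<in> borel_measurable borel"
proof -
  let ?e = "\<lambda>t :: real. (\<theta>, sqrt t *\<^sub>R axis undefined 1) :: (real^'p) \<times> (real^'n)"
  have [measurable]: "?e \<in> borel_measurable borel"
    by (intro borel_measurable_continuous_onI continuous_intros)
  have "(\<lambda>t. if 0 \<le> t then sample_density d f \<theta> \<sigma> (?e t) else 0) \<in> borel_measurable borel"
    by measurable
  also have "(\<lambda>t. if 0 \<le> t then sample_density d f \<theta> \<sigma> (?e t) else 0) =
     (\<lambda>t. if 0 \<le> t then (\<Prod>i\<in>UNIV. d $ i powr (- 1 / 2)) * \<sigma> powi (- int CARD('p) - int CARD('n)) * f (t / \<sigma>\<^sup>2) else 0)"
    by (auto simp: fun_eq_iff sample_density_eq[OF d] inner_axis_axis)
  finally show ?thesis .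
qed

section \<open>The theorem\<close>

lemma c_vec_pos:
  assumes "\<And>i. 0 < d $ i"
  shows "0 < c_vec d j \<eta> $ i"
  using assms[of i] assms[of fst_ix] by (simp add: c_vec_def)

text \<open>The ratio d_1/d_i grows with i, and 1 - j < \<eta> makes the exponent positive.\<close>

lemma c_vec_mono:
  fixes d :: "real^'p::{finite,linorder}"
  assumes d: "\<And>i. 0 < d $ i" and dec: "\<And>i k. i \<le> k \<Longrightarrow> d $ k \<le> d $ i"
    and "1 - j < \<eta>" "i \<le> k"
  shows "c_vec d j \<eta> $ i \<le> c_vec d j \<eta> $ k"
proof -
  have "d $ fst_ix / d $ i \<le> d $ fst_ix / d $ k"
    using d dec[OF \<open>i \<le> k\<close>] by (intro divide_left_mono) (auto simp: less_imp_le)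
  then show ?thesis unfolding c_vec_def using assms by (auto intro!: powr_mono2 simp: less_imp_le)
qed

lemma c_vec_strict:
  fixes d :: "real^'p::{finite,linorder}"
  assumes d: "\<And>i. 0 < d $ i" and "1 - j < \<eta>" "d $ last_ix < d $ fst_ix"
  shows "c_vec d j \<eta> $ fst_ix < c_vec d j \<eta> $ last_ix"
proof -
  have "1 < (d $ fst_ix / d $ last_ix) powr (j - 1 + \<eta>)"
    using assms by (subst gr_one_powr) auto
  then show ?thesis using d[of fst_ix] by (simp add: c_vec_def)
qed

lemma weight_c_vec:
  fixes d :: "real^'p::{finite,linorder}"
  assumes d: "\<And>i. 0 < d $ i"
  shows "d $ i powr (1 - j) / c_vec d j \<eta> $ i = d $ fst_ix powr (1 - j) * (d $ i / d $ fst_ix) powr \<eta>"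
  using d[of i] d[of fst_ix]
  by (simp add: c_vec_def powr_divide powr_add powr_diff field_simps)

theorem theorem4p1:
  fixes d c :: "real^'p::{finite,linorder}"
    and j \<eta> L :: real
    and f \<phi> \<phi>' :: "real \<Rightarrow> real"
  assumes p: "CARD('p) \<ge> 3"
    and d_pos: "\<And>i. 0 < d $ i"
    and d_decreasing: "\<And>i k. i \<le> k \<Longrightarrow> d $ k \<le> d $ i"
    and j: "power_sum d (1 - j) - 2 > 0"
    and \<eta>_strict: "d $ fst_ix > d $ snd_ix \<Longrightarrow> max 0 (1 - j) < \<eta> \<and> \<eta> < eta_star d"
    and \<eta>_equal: "d $ fst_ix = d $ snd_ix \<Longrightarrow> \<eta> > max (1 - j) 0"
    and c: "c = c_vec d j \<eta>"
    and f_nonneg: "\<And>t. 0 \<le> t \<Longrightarrow> 0 \<le> f t"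
    and f_measurable: "\<And>\<theta> \<sigma>. 0 < \<sigma> \<Longrightarrow>
      (sample_density d f \<theta> \<sigma> :: (real^'p::{finite,linorder}) \<times> (real^'n) \<Rightarrow> real) \<in> borel_measurable borel"
    and f_prob: "\<And>\<theta> \<sigma>. 0 < \<sigma> \<Longrightarrow>
      prob_space (sample_dist d f \<theta> \<sigma> :: ((real^'p::{finite,linorder}) \<times> (real^'n)) measure)"
    and second_moments: "\<And>\<theta> \<sigma> i. 0 < \<sigma> \<Longrightarrow>
      integrable (sample_dist d f \<theta> \<sigma> :: ((real^'p::{finite,linorder}) \<times> (real^'n)) measure) (\<lambda>(x, z). (x $ i)\<^sup>2)"
    and \<phi>_deriv: "\<And>w. 0 < w \<Longrightarrow> (\<phi> has_real_derivative \<phi>' w) (at w)"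
    and \<phi>_increasing: "\<And>w. 0 < w \<Longrightarrow> 0 \<le> \<phi>' w"
    and \<phi>_bounds: "\<And>w. 0 < w \<Longrightarrow> 0 \<le> \<phi> w / w \<and> \<phi> w / w \<le> v_plus d c"
    and \<phi>_limit: "(\<phi> \<longlongrightarrow> L) at_top" "L \<le> u_plus d \<eta> CARD('n)"
  shows "minimax d f j (theta_hat d c \<phi> :: (real^'p::{finite,linorder}) \<times> (real^'n) \<Rightarrow> real^'p::{finite,linorder})
    \<and> cond_number_decreasing d c \<phi>
    \<and> (\<forall>i k. i \<le> k \<longrightarrow> c $ i \<le> c $ k)"
proof -
  have \<eta>: "0 < \<eta>" "1 - j < \<eta>"
  proof -
    \<comment> \<open>Excludes d_1 < d_2, so one of the two hypotheses on \<eta> applies.\<close>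
    have "d $ snd_ix \<le> d $ fst_ix" by (rule d_decreasing) simp
    then show "0 < \<eta>" "1 - j < \<eta>" using \<eta>_strict \<eta>_equal by (auto simp: le_less)
  qed
  have c_pos: "0 < c $ i" for i unfolding c by (rule c_vec_pos[OF d_pos])
  have c_mono: "c $ i \<le> c $ k" if "i \<le> k" for i k
    unfolding c by (rule c_vec_mono[OF d_pos d_decreasing \<eta>(2) that])
  have "cond_number_decreasing d c \<phi>"
    by (rule cond_number_decreasingI[OF d_pos d_decreasing c_pos c_mono _ _ \<phi>_bounds])
      (use c_vec_strict[OF d_pos \<eta>(2)] p in \<open>auto simp: c\<close>)
  moreover have "minimax d f j (theta_hat d c \<phi> :: (real^'p::{finite,linorder}) \<times> (real^'n) \<Rightarrow> real^'p::{finite,linorder})"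
  proof -
    \<comment> \<open>The weight at i = 1, which is the largest because 0 < \<eta>.\<close>
    define m where "m = d $ fst_ix powr (1 - j)"
    have m: "0 < m" using d_pos[of fst_ix] by (simp add: m_def)
    define g where "g \<sigma> t = (if 0 \<le> t then (\<Prod>i\<in>UNIV. d $ i powr (- 1 / 2)) *
      \<sigma> powi (- int CARD('p) - int CARD('n)) * f (t / \<sigma>\<^sup>2) else 0)" for \<sigma> t
    define Q where "Q \<theta> y = (\<Sum>i\<in>UNIV. (fst y $ i - \<theta> $ i)\<^sup>2 / d $ i) + snd y \<bullet> snd y"
      for \<theta> :: "real^'p::{finite,linorder}" and y :: "(real^'p::{finite,linorder}) \<times> (real^'n)"
    have \<phi>_le: "\<phi> w \<le> L" if "0 < w" for w
    proof (rule tendsto_lowerbound[OF \<phi>_limit(1) _ trivial_limit_at_top_linorder])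
      show "eventually (\<lambda>x. \<phi> w \<le> \<phi> x) at_top"
        using eventually_ge_at_top[of w]
        by (rule eventually_mono) (rule nondecreasing_on_positives[OF \<phi>_deriv \<phi>_increasing that])
    qed
    have weight_le: "d $ i powr (1 - j) / c $ i \<le> m" for i
    proof -
      have "(d $ i / d $ fst_ix) powr \<eta> \<le> 1"
        using d_pos d_decreasing[of fst_ix i] \<eta> by (intro powr_le1) (auto simp: less_imp_le)
      then show ?thesis
        unfolding c weight_c_vec[OF d_pos] m_def[symmetric] using m by simp
    qed
    \<comment> \<open>The definition of u_+ with its denominator cleared. The 4 in
      \<open>weight_sum\<close> is the 2 * 2 on the right.\<close>
    have "L * (real CARD('n) + 2) \<le> 2 * (power_sum d \<eta> - 2)"
      using \<phi>_limit(2) by (simp add: u_plus_def field_simps)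
    then have "(4 + (real CARD('n) + 2) * L) * m \<le> (2 * power_sum d \<eta>) * m"
      using m by (intro mult_right_mono) (auto simp: algebra_simps)
    also have "\<dots> = 2 * (\<Sum>i\<in>UNIV. d $ i powr (1 - j) / c $ i)"
      unfolding c weight_c_vec[OF d_pos] m_def[symmetric] power_sum_def
      by (simp add: sum_distrib_left mult_ac)
    finally have weight_sum: "(4 + (real CARD('n) + 2) * L) * m \<le> 2 * (\<Sum>i\<in>UNIV. d $ i powr (1 - j) / c $ i)" .
    have fst_meas[measurable]: "(\<lambda>y :: (real^'p::{finite,linorder}) \<times> (real^'n). fst y $ i) \<in> borel_measurable borel" for i
      by (intro borel_measurable_continuous_onI continuous_intros)
    have model: "shrinkage d c \<theta> j L (v_plus d c) m \<phi> \<phi>' (g \<sigma>) (Q \<theta>)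
        (sample_dist d f \<theta> \<sigma> :: ((real^'p::{finite,linorder}) \<times> (real^'n)) measure) (density lborel (\<lambda>y. tail (g \<sigma>) (Q \<theta> y)))"
      if \<sigma>: "0 < \<sigma>" for \<theta> \<sigma>
    proof (rule shrinkage.intro)
      show "0 < d $ i" "0 < c $ i" for i by (rule d_pos c_pos)+
      show "2 \<le> CARD('p)" using p by simp
      show "g \<sigma> \<in> borel_measurable borel"
        unfolding g_def[abs_def] by (rule measurable_generator[OF d_pos \<sigma> f_measurable[OF \<sigma>]])
      show "0 \<le> g \<sigma> t" for t
      proof -
        have "0 \<le> (\<Prod>i\<in>UNIV. d $ i powr (- 1 / 2))" by (rule prod_nonneg) simp
        moreover have "0 \<le> \<sigma> powi (- int CARD('p) - int CARD('n))"
          by (rule zero_le_power_int) (use \<sigma> in simp)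
        moreover have "0 \<le> f (t / \<sigma>\<^sup>2)" if "0 \<le> t" by (rule f_nonneg) (use that in simp)
        ultimately show ?thesis unfolding g_def by (simp only: mult_nonneg_nonneg split: if_split) simp
      qed
      show "(\<phi> has_real_derivative \<phi>' w) (at w)" "0 \<le> \<phi>' w" "0 \<le> \<phi> w" "\<phi> w / w \<le> v_plus d c" "\<phi> w \<le> L" if "0 < w" for w
        using \<phi>_deriv[OF that] \<phi>_increasing[OF that] \<phi>_bounds[OF that] \<phi>_le[OF that] that
        by (auto simp: zero_le_divide_iff)
      show "Q \<theta> = (\<lambda>y. (\<Sum>i\<in>UNIV. (fst y $ i - \<theta> $ i)\<^sup>2 / d $ i) + snd y \<bullet> snd y)"
        by (simp add: Q_def fun_eq_iff)
      have "sample_density d f \<theta> \<sigma> y = g \<sigma> (Q \<theta> y)" for y :: "(real^'p::{finite,linorder}) \<times> (real^'n)"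
      proof -
        have "0 \<le> Q \<theta> y" unfolding Q_def
          by (intro add_nonneg_nonneg sum_nonneg) (auto simp: d_pos less_imp_le)
        then show ?thesis
          using sample_density_eq[OF d_pos, of f \<theta> \<sigma> "fst y" "snd y"] by (simp add: g_def Q_def)
      qed
      then show "sample_dist d f \<theta> \<sigma> = density lborel (\<lambda>y. ennreal (g \<sigma> (Q \<theta> y)))"
        by (simp add: sample_dist_def)
      show "finite_measure (sample_dist d f \<theta> \<sigma> :: ((real^'p::{finite,linorder}) \<times> (real^'n)) measure)"
        using f_prob[OF \<sigma>, of \<theta>] by (rule prob_space.finite_measure)
      show "integrable (sample_dist d f \<theta> \<sigma> :: ((real^'p::{finite,linorder}) \<times> (real^'n)) measure) (\<lambda>y. (fst y $ i)\<^sup>2)" for i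
        using second_moments[OF \<sigma>, of \<theta> i] by (simp only: case_prod_unfold)
    qed (fact weight_le weight_sum refl)+
    show ?thesis unfolding minimax_def
    proof (intro conjI allI impI)
      show "(theta_hat d c \<phi> :: (real^'p::{finite,linorder}) \<times> (real^'n) \<Rightarrow> real^'p::{finite,linorder}) \<in> borel_measurable borel"
        \<comment> \<open>The estimator does not involve the parameters, so any instance will do;
          \<sigma> = 1 and \<theta> = 0 are taken.\<close>
        by (rule shrinkage.theta_hat_measurable[OF model[of 1 0]]) simp
      fix \<delta> :: "(real^'p::{finite,linorder}) \<times> (real^'n) \<Rightarrow> real^'p::{finite,linorder}"
      assume \<delta>: "\<delta> \<in> borel_measurable borel"
      have "risk d f j (theta_hat d c \<phi> :: (real^'p::{finite,linorder}) \<times> (real^'n) \<Rightarrow> real^'p::{finite,linorder}) \<theta> \<sigma> \<le> max_risk d f j \<delta>"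
        if \<sigma>: "0 < \<sigma>" for \<theta> \<sigma>
      proof -
        have "risk d f j (theta_hat d c \<phi> :: (real^'p::{finite,linorder}) \<times> (real^'n) \<Rightarrow> real^'p::{finite,linorder}) \<theta> \<sigma> \<le>
            risk d f j (fst :: (real^'p::{finite,linorder}) \<times> (real^'n) \<Rightarrow> real^'p::{finite,linorder}) \<theta> \<sigma>"
          unfolding risk_def by (rule shrinkage.quadratic_risk_le[OF model[OF \<sigma>]]) (use \<sigma> in simp)
        also have "\<dots> \<le> max_risk d f j \<delta>"
          by (rule risk_fst_le_max_risk[OF d_pos \<sigma> f_measurable[OF \<sigma>] \<delta>])
        finally show ?thesis .
      qed
      then show "max_risk d f j (theta_hat d c \<phi> :: (real^'p::{finite,linorder}) \<times> (real^'n) \<Rightarrow> real^'p::{finite,linorder}) \<le> max_risk d f j \<delta>"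
        unfolding max_risk_def[of d f j "theta_hat d c \<phi>"] by (auto intro!: SUP_least)
    qed
  qed
  ultimately show ?thesis using c_mono by blast
qed

end
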